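(* Let $N\ge1$. The universal family $T:U(N)\to\mathrm{Lag}^-$, $U\mapsto\{(T_Uf,f)\mid f\in D(T_U)\}$, is homotopic to the inclusion $U(N)\hookrightarrow\mathrm{Lag}^-$ provided by the Arnold isomorphism, i.e. to the map $$U\mapsto \{((1+U)v,-i(1-U)v)\mid v\in\mathbb C^N\}\oplus (W\oplus0).$$
   Context: Let $H=L^2([0,1];\mathbb C^N)$, $\hat H=H\oplus H$, $H^-=0\oplus H$, $J(x,y)=(y,-x)$. A subspace $L\subset\hat H$ is lagrangian if $JL=L^\perp$; the set $\mathrm{Lag}$ of lagrangians is topologized by $L\mapsto P_L$ (orthogonal projection) in operator norm, and $\mathrm{Lag}^-$ is the subspace of those $L$ with $\dim(L\cap H^-)<\infty$ and $L+H^-$ closed. For $U\in U(N)$, $T_U=-i\frac{d}{dt}$ is the self-adjoint Fredholm operator on $H$ with domain $D(T_U)=L^{1,2}_U([0,1])$, the completion in the Sobolev norm $\|f\|_{1,2}^2=\int_0^1(|f'|^2+|f|^2)\,dt$ of $\{f\in C^\infty([0,1];\mathbb C^N)\mid f(1)=Uf(0)\}$. $\mathbb C^N\subset H$ denotes the constant functions, $W$ its orthogonal complement in $H$. The map $U\mapsto\{((1+U)v,-i(1-U)v)\mid v\in\mathbb C^N\}$ is the finite-dimensional Arnold (Cayley graph) diffeomorphism $U(N)\to\mathrm{Lag}(\mathbb C^N\oplus\mathbb C^N)$, and the inclusion $\mathrm{Lag}(\mathbb C^N\oplus\mathbb C^N)\hookrightarrow\mathrm{Lag}^-$ adds $W\oplus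 0\subset H^+=H\oplus0$. *)

theory Defs
  imports "HOL-Analysis.Analysis"
begin

section \<open>Complex inner product spaces\<close>

text \<open>The complex inner product is linear in its first argument.\<close>

class complex_inner = real_inner +
  fixes scaleC :: "complex \<Rightarrow> 'a \<Rightarrow> 'a"  (infixr "*\<^sub>C" 75)
    and cinner :: "'a \<Rightarrow> 'a \<Rightarrow> complex"
  assumes scaleC_add_right: "c *\<^sub>C (x + y) = c *\<^sub>C x + c *\<^sub>C y"
    and scaleC_add_left: "(c + d) *\<^sub>C x = c *\<^sub>C x + d *\<^sub>C x"
    and scaleC_scaleC: "c *\<^sub>C (d *\<^sub>C x) = (c * d) *\<^sub>C x"
    and scaleR_scaleC: "scaleR r x = complex_of_real r *\<^sub>C x"
    and cinner_commute: "cinner x y = cnj (cinner y x)"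
    and cinner_add_left: "cinner (x + y) z = cinner x z + cinner y z"
    and cinner_scaleC_left: "cinner (c *\<^sub>C x) y = c * cinner x y"
    and inner_eq_Re_cinner: "inner x y = Re (cinner x y)"

global_interpretation complex_vector: vector_space "scaleC :: complex \<Rightarrow> 'a \<Rightarrow> 'a::complex_inner"
  defines csubspace = complex_vector.subspace
    and cspan = complex_vector.span
  by unfold_locales
    (simp_all add: scaleC_add_right scaleC_add_left scaleC_scaleC scaleR_scaleC[of 1, simplified, symmetric])

definition cortho :: "'a::complex_inner set \<Rightarrow> 'a set" where
  "cortho L = {x. \<forall>y\<in>L. cinner x y = 0}"

definition cfinite_dim :: "'a::complex_inner set \<Rightarrow> bool" where
  "cfinite_dim S \<longleftrightarrow> (\<exists>B. finite B \<and> cspan B = S)"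

text \<open>The orthogonal projection; it exists for closed complex subspaces of a complete space.\<close>

definition ortho_proj :: "'a::complex_inner set \<Rightarrow> 'a \<Rightarrow>\<^sub>L 'a" where
  "ortho_proj L = (THE P. \<forall>x. blinfun_apply P x \<in> L \<and> x - blinfun_apply P x \<in> cortho L)"

text \<open>The Hilbert direct sum: the library norm on a product of inner product spaces is already the
  Euclidean one.\<close>

instantiation prod :: (complex_inner, complex_inner) complex_inner
begin

definition "c *\<^sub>C p = (c *\<^sub>C fst p, c *\<^sub>C snd p)"

definition "cinner p q = cinner (fst p) (fst q) + cinner (snd p) (snd q)"

instance
proof
  fix p q :: "'a \<times> 'b"
  show "cinner p q = cnj (cinner q p)"
    unfolding cinner_prod_def complex_cnj_add
    by (simp only: cinner_commute[of "fst q"] cinner_commute[of "snd q"] complex_cnj_cnj)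
qed (auto simp: scaleC_prod_def cinner_prod_def inner_prod_def scaleC_add_right scaleC_add_left
    scaleC_scaleC scaleR_scaleC cinner_add_left cinner_scaleC_left inner_eq_Re_cinner
    prod_eq_iff algebra_simps)

end


section \<open>The space of square integrable functions on the unit interval\<close>

abbreviation unit_measure :: "real measure" where
  "unit_measure \<equiv> lebesgue_on {0..1}"

definition square_integrable :: "(real \<Rightarrow> complex^'n) \<Rightarrow> bool" where
  "square_integrable f \<longleftrightarrow> f \<in> borel_measurable unit_measure \<and>
     integrable unit_measure (\<lambda>t. (norm (f t))\<^sup>2)"

definition L2_rel :: "(real \<Rightarrow> complex^'n) \<Rightarrow> (real \<Rightarrow> complex^'n) \<Rightarrow> bool" where
  "L2_rel f g \<longleftrightarrow> square_integrable f \<and> square_integrable g \<and> (AE t in unit_measure. f t = g t)"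

lemma square_integrable_const [simp]: "square_integrable (\<lambda>_. v)"
proof -
  have "finite_measure unit_measure"
    by (intro finite_measureI) (simp add: space_restrict_space emeasure_restrict_space)
  then show ?thesis
    unfolding square_integrable_def by (simp add: finite_measure.integrable_const)
qed

quotient_type 'n L2 = "real \<Rightarrow> complex^('n::finite)" / partial: L2_rel
proof (rule part_equivpI)
  show "\<exists>f. L2_rel f (f :: real \<Rightarrow> complex^'n)"
    by (rule exI[of _ "\<lambda>_. 0"]) (simp add: L2_rel_def)
  show "symp (L2_rel :: (real \<Rightarrow> complex^'n) \<Rightarrow> _)"
    by (auto simp: symp_def L2_rel_def elim: eventually_mono)
  show "transp (L2_rel :: (real \<Rightarrow> complex^'n) \<Rightarrow> _)"
  proof (rule transpI)
    fix f g h :: "real \<Rightarrow> complex^'n"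
    assume fg: "L2_rel f g" and gh: "L2_rel g h"
    have "AE t in unit_measure. f t = g t" "AE t in unit_measure. g t = h t"
      using fg gh by (auto simp: L2_rel_def)
    then have "AE t in unit_measure. f t = h t"
      by eventually_elim simp
    then show "L2_rel f h"
      using fg gh by (simp add: L2_rel_def)
  qed
qed

lemma integrable_norm_mult:
  assumes "square_integrable f" "square_integrable g"
  shows "integrable unit_measure (\<lambda>t. norm (f t) * norm (g t))"
proof (rule Bochner_Integration.integrable_bound)
  show "integrable unit_measure (\<lambda>t. (norm (f t))\<^sup>2 + (norm (g t))\<^sup>2)"
    using assms by (auto simp: square_integrable_def)
  show "(\<lambda>t. norm (f t) * norm (g t)) \<in> borel_measurable unit_measure"
    using assms by (auto simp: square_integrable_def)
  have "a * b \<le> a\<^sup>2 + b\<^sup>2" if "0 \<le> a" "0 \<le> b" for a b :: real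
    using sum_squares_bound[of a b] mult_nonneg_nonneg[OF that] by linarith
  then show "AE t in unit_measure. norm (norm (f t) * norm (g t)) \<le> norm ((norm (f t))\<^sup>2 + (norm (g t))\<^sup>2)"
    by simp
qed

lemma square_integrable_add:
  assumes "square_integrable f" "square_integrable g"
  shows "square_integrable (\<lambda>t. f t + g t)"
  unfolding square_integrable_def
proof
  show *: "(\<lambda>t. f t + g t) \<in> borel_measurable unit_measure"
    using assms by (auto simp: square_integrable_def)
  show "integrable unit_measure (\<lambda>t. (norm (f t + g t))\<^sup>2)"
  proof (rule Bochner_Integration.integrable_bound)
    show "integrable unit_measure (\<lambda>t. (norm (f t))\<^sup>2 + (norm (g t))\<^sup>2 + 2 * (norm (f t) * norm (g t)))"
      using assms integrable_norm_mult[OF assms] by (auto simp: square_integrable_def)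
    show "(\<lambda>t. (norm (f t + g t))\<^sup>2) \<in> borel_measurable unit_measure"
      using * by measurable
    have "(norm (f t + g t))\<^sup>2 \<le> (norm (f t) + norm (g t))\<^sup>2" for t
      by (intro power_mono norm_triangle_ineq) simp
    then show "AE t in unit_measure. norm ((norm (f t + g t))\<^sup>2) \<le>
        norm ((norm (f t))\<^sup>2 + (norm (g t))\<^sup>2 + 2 * (norm (f t) * norm (g t)))"
      by (simp add: power2_sum mult.assoc)
  qed
qed

lemma norm_vector_scaleC: "norm (c *s (v :: complex^'n)) = cmod c * norm v"
  by (simp add: norm_vec_def norm_mult L2_set_right_distrib)

lemma borel_measurable_vec_iff:
  fixes f :: "'a \<Rightarrow> complex^'n"
  shows "f \<in> borel_measurable M \<longleftrightarrow> (\<forall>i. (\<lambda>t. f t $ i) \<in> borel_measurable M)"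
proof
  assume "f \<in> borel_measurable M"
  moreover have "(\<lambda>v :: complex^'n. v $ i) \<in> borel_measurable borel" for i
    by (intro borel_measurable_continuous_onI continuous_intros)
  ultimately show "\<forall>i. (\<lambda>t. f t $ i) \<in> borel_measurable M"
    by (auto intro: measurable_compose)
next
  assume "\<forall>i. (\<lambda>t. f t $ i) \<in> borel_measurable M"
  then show "f \<in> borel_measurable M"
    by (subst borel_measurable_euclidean_space) (auto simp: Basis_vec_def inner_axis intro!: borel_measurable_inner)
qed

lemma square_integrable_scaleC:
  assumes "square_integrable f"
  shows "square_integrable (\<lambda>t. c *s f t)"
  using assms
  by (auto simp: square_integrable_def borel_measurable_vec_iff norm_vector_scaleC power_mult_distrib
      intro!: borel_measurable_times)

lemma scaleR_vec_eq: "r *\<^sub>R (v :: complex^'n) = complex_of_real r *s v"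
  by (simp add: vec_eq_iff complex_eq_iff)

lemma square_integrable_scaleR:
  "square_integrable f \<Longrightarrow> square_integrable (\<lambda>t. r *\<^sub>R f t)"
  unfolding scaleR_vec_eq by (rule square_integrable_scaleC)

definition vec_cinner :: "complex^'n \<Rightarrow> complex^'n \<Rightarrow> complex" where
  "vec_cinner v w = (\<Sum>i\<in>UNIV. v $ i * cnj (w $ i))"

lemma inner_vec_eq_Re: "v \<bullet> w = Re (vec_cinner v w)"
  by (simp add: inner_vec_def vec_cinner_def inner_complex_def)

lemma integrable_vec_cinner:
  assumes "square_integrable f" "square_integrable g"
  shows "integrable unit_measure (\<lambda>t. vec_cinner (f t) (g t))"
  unfolding vec_cinner_def
proof (rule Bochner_Integration.integrable_sum)
  fix i
  show "integrable unit_measure (\<lambda>t. f t $ i * cnj (g t $ i))"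
  proof (rule Bochner_Integration.integrable_bound[OF integrable_norm_mult[OF assms]])
    have "(\<lambda>t. f t $ i) \<in> borel_measurable unit_measure" "(\<lambda>t. g t $ i) \<in> borel_measurable unit_measure"
      using assms by (auto simp: square_integrable_def borel_measurable_vec_iff)
    moreover have "cnj \<in> borel_measurable borel"
      by (intro borel_measurable_continuous_onI continuous_intros)
    ultimately show "(\<lambda>t. f t $ i * cnj (g t $ i)) \<in> borel_measurable unit_measure"
      by (intro borel_measurable_times) (auto intro: measurable_compose)
    show "AE t in unit_measure. norm (f t $ i * cnj (g t $ i)) \<le> norm (norm (f t) * norm (g t))"
      by (simp add: norm_mult mult_mono Finite_Cartesian_Product.norm_nth_le)
  qed
qed

lemma integrable_inner:
  assumes "square_integrable f" "square_integrable g"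
  shows "integrable unit_measure (\<lambda>t. f t \<bullet> g t)"
  unfolding inner_vec_eq_Re using integrable_vec_cinner[OF assms] by simp

instantiation L2 :: (finite) complex_inner
begin

lift_definition zero_L2 :: "'a L2" is "\<lambda>_. 0"
  by (simp add: L2_rel_def)

lift_definition plus_L2 :: "'a L2 \<Rightarrow> 'a L2 \<Rightarrow> 'a L2" is "\<lambda>f g t. f t + g t"
  unfolding L2_rel_def by (auto intro: square_integrable_add elim: eventually_elim2)

lift_definition scaleC_L2 :: "complex \<Rightarrow> 'a L2 \<Rightarrow> 'a L2" is "\<lambda>c f t. c *s f t"
  unfolding L2_rel_def by (auto intro: square_integrable_scaleC elim: eventually_mono)

lift_definition scaleR_L2 :: "real \<Rightarrow> 'a L2 \<Rightarrow> 'a L2" is "\<lambda>r f t. r *\<^sub>R f t"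
  unfolding L2_rel_def by (auto intro: square_integrable_scaleR elim: eventually_mono)

lift_definition uminus_L2 :: "'a L2 \<Rightarrow> 'a L2" is "\<lambda>f t. - f t"
  unfolding L2_rel_def using square_integrable_scaleR[of _ "-1"] by (auto elim: eventually_mono)

definition minus_L2 :: "'a L2 \<Rightarrow> 'a L2 \<Rightarrow> 'a L2" where
  "minus_L2 x y = x + - y"

lift_definition inner_L2 :: "'a L2 \<Rightarrow> 'a L2 \<Rightarrow> real" is
  "\<lambda>f g. integral\<^sup>L unit_measure (\<lambda>t. f t \<bullet> g t)"
  unfolding L2_rel_def
  by (rule integral_cong_AE) (auto simp: square_integrable_def elim: eventually_elim2)

lift_definition cinner_L2 :: "'a L2 \<Rightarrow> 'a L2 \<Rightarrow> complex" is
  "\<lambda>f g. integral\<^sup>L unit_measure (\<lambda>t. vec_cinner (f t) (g t))"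
  unfolding L2_rel_def
  by (rule integral_cong_AE)
    (auto intro: borel_measurable_integrable integrable_vec_cinner elim: eventually_elim2)

definition norm_L2 :: "'a L2 \<Rightarrow> real" where
  "norm_L2 x = sqrt (inner x x)"

definition sgn_L2 :: "'a L2 \<Rightarrow> 'a L2" where
  "sgn_L2 x = inverse (norm x) *\<^sub>R x"

definition dist_L2 :: "'a L2 \<Rightarrow> 'a L2 \<Rightarrow> real" where
  "dist_L2 x y = norm (x - y)"

definition uniformity_L2 :: "('a L2 \<times> 'a L2) filter" where
  "uniformity_L2 = (INF e\<in>{0<..}. principal {(x, y). dist x y < e})"

definition open_L2 :: "'a L2 set \<Rightarrow> bool" where
  "open_L2 U \<longleftrightarrow> (\<forall>x\<in>U. \<forall>\<^sub>F (x', y) in uniformity. x' = x \<longrightarrow> y \<in> U)"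

instance
proof
  fix x y z :: "'a L2" and r s :: real and c d :: complex
  show "x + y + z = x + (y + z)"
    by transfer (auto simp: L2_rel_def add.assoc intro!: square_integrable_add)
  show "x + y = y + x"
    by transfer (auto simp: L2_rel_def add.commute intro!: square_integrable_add)
  show "0 + x = x"
    by transfer (auto simp: L2_rel_def)
  have neg: "square_integrable (\<lambda>t. - f t)" if "square_integrable f" for f :: "real \<Rightarrow> complex^'a"
    using square_integrable_scaleR[OF that, of "-1"] by simp
  show "- x + x = 0"
    by transfer (auto simp: L2_rel_def)
  show "x - y = x + - y"
    by (simp add: minus_L2_def)
  show "r *\<^sub>R (x + y) = r *\<^sub>R x + r *\<^sub>R y"
    by transfer (auto simp: L2_rel_def scaleR_add_right
        intro!: square_integrable_add square_integrable_scaleR)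
  show "(r + s) *\<^sub>R x = r *\<^sub>R x + s *\<^sub>R x"
    by transfer (auto simp: L2_rel_def scaleR_add_left
        intro!: square_integrable_add square_integrable_scaleR)
  show "r *\<^sub>R s *\<^sub>R x = (r * s) *\<^sub>R x"
    by transfer (auto simp: L2_rel_def intro!: square_integrable_scaleR)
  show "1 *\<^sub>R x = x"
    by transfer (auto simp: L2_rel_def)
  show "sgn x = inverse (norm x) *\<^sub>R x"
    by (rule sgn_L2_def)
  show "dist x y = norm (x - y)"
    by (rule dist_L2_def)
  show "(uniformity :: ('a L2 \<times> 'a L2) filter) = (INF e\<in>{0<..}. principal {(x, y). dist x y < e})"
    by (rule uniformity_L2_def)
  show "open U \<longleftrightarrow> (\<forall>x\<in>U. \<forall>\<^sub>F (x', y) in uniformity. x' = x \<longrightarrow> y \<in> U)" for U :: "'a L2 set"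
    by (rule open_L2_def)
  show "x \<bullet> y = y \<bullet> x"
    by transfer (simp add: inner_commute)
  show "(x + y) \<bullet> z = x \<bullet> z + y \<bullet> z"
    by transfer (simp add: L2_rel_def inner_add_left integrable_inner)
  show "r *\<^sub>R x \<bullet> y = r * (x \<bullet> y)"
    by transfer simp
  show "0 \<le> x \<bullet> x"
    by transfer simp
  show "x \<bullet> x = 0 \<longleftrightarrow> x = 0"
  proof transfer
    fix f :: "real \<Rightarrow> complex^'a"
    assume "L2_rel f f"
    then have f: "square_integrable f" by (simp add: L2_rel_def)
    have "integral\<^sup>L unit_measure (\<lambda>t. f t \<bullet> f t) = 0 \<longleftrightarrow> (AE t in unit_measure. f t \<bullet> f t = 0)"
      by (rule integral_nonneg_eq_0_iff_AE) (use integrable_inner[OF f f] in auto)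
    then show "integral\<^sup>L unit_measure (\<lambda>t. f t \<bullet> f t) = 0 \<longleftrightarrow> L2_rel f (\<lambda>_. 0)"
      using f by (simp add: L2_rel_def)
  qed
  show "norm x = sqrt (x \<bullet> x)"
    by (rule norm_L2_def)
  show "c *\<^sub>C (x + y) = c *\<^sub>C x + c *\<^sub>C y"
    by transfer (auto simp: L2_rel_def vector_add_ldistrib
        intro!: square_integrable_add square_integrable_scaleC)
  show "(c + d) *\<^sub>C x = c *\<^sub>C x + d *\<^sub>C x"
    by transfer (auto simp: L2_rel_def vector_sadd_rdistrib
        intro!: square_integrable_add square_integrable_scaleC)
  show "c *\<^sub>C d *\<^sub>C x = (c * d) *\<^sub>C x"
    by transfer (auto simp: L2_rel_def vector_smult_assoc intro!: square_integrable_scaleC)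
  show "r *\<^sub>R x = complex_of_real r *\<^sub>C x"
    by transfer (auto simp: L2_rel_def scaleR_vec_eq intro!: square_integrable_scaleC)
  show "cinner x y = cnj (cinner y x)"
  proof transfer
    fix f g :: "real \<Rightarrow> complex^'a"
    have "vec_cinner (f t) (g t) = cnj (vec_cinner (g t) (f t))" for t
      by (simp add: vec_cinner_def mult.commute)
    then show "integral\<^sup>L unit_measure (\<lambda>t. vec_cinner (f t) (g t)) =
        cnj (integral\<^sup>L unit_measure (\<lambda>t. vec_cinner (g t) (f t)))"
      by simp
  qed
  show "cinner (x + y) z = cinner x z + cinner y z"
  proof transfer
    fix f g h :: "real \<Rightarrow> complex^'a"
    assume "L2_rel f f" "L2_rel g g" "L2_rel h h"
    moreover have "vec_cinner (f t + g t) (h t) = vec_cinner (f t) (h t) + vec_cinner (g t) (h t)" for t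
      by (simp add: vec_cinner_def distrib_right sum.distrib)
    ultimately show "integral\<^sup>L unit_measure (\<lambda>t. vec_cinner (f t + g t) (h t)) =
        integral\<^sup>L unit_measure (\<lambda>t. vec_cinner (f t) (h t)) +
        integral\<^sup>L unit_measure (\<lambda>t. vec_cinner (g t) (h t))"
      by (simp add: L2_rel_def integrable_vec_cinner)
  qed
  show "cinner (c *\<^sub>C x) y = c * cinner x y"
  proof transfer
    fix c and f g :: "real \<Rightarrow> complex^'a"
    have "vec_cinner (c *s f t) (g t) = c * vec_cinner (f t) (g t)" for t
      by (simp add: vec_cinner_def sum_distrib_left mult.assoc)
    then show "integral\<^sup>L unit_measure (\<lambda>t. vec_cinner (c *s f t) (g t)) =
        c * integral\<^sup>L unit_measure (\<lambda>t. vec_cinner (f t) (g t))"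
      by simp
  qed
  show "x \<bullet> y = Re (cinner x y)"
    by transfer (simp add: L2_rel_def inner_vec_eq_Re integrable_vec_cinner)
qed

end

text \<open>The class of a function; meaningful only if the function is square integrable.\<close>

definition L2_class :: "(real \<Rightarrow> complex^'n) \<Rightarrow> 'n L2" where
  "L2_class f = abs_L2 f"

definition const_L2 :: "complex^'n \<Rightarrow> 'n L2" where
  "const_L2 v = L2_class (\<lambda>_. v)"


section \<open>Lagrangians\<close>

type_synonym 'n Hhat = "'n L2 \<times> 'n L2"

definition Jhat :: "'n::finite Hhat \<Rightarrow> 'n Hhat" where
  "Jhat p = (snd p, - fst p)"

definition Hminus :: "'n::finite Hhat set" where
  "Hminus = {0} \<times> UNIV"

definition Lag :: "'n::finite Hhat set set" where
  "Lag = {L. csubspace L \<and> Jhat ` L = cortho L}"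

definition Lag_minus :: "'n::finite Hhat set set" where
  "Lag_minus = {L \<in> Lag. cfinite_dim (L \<inter> Hminus) \<and> closed {x + y | x y. x \<in> L \<and> y \<in> Hminus}}"

definition Lag_topology :: "'n::finite Hhat set topology" where
  "Lag_topology = pullback_topology Lag ortho_proj euclidean"

definition Lag_minus_topology :: "'n::finite Hhat set topology" where
  "Lag_minus_topology = subtopology Lag_topology Lag_minus"


section \<open>The universal family\<close>

definition adjoint_matrix :: "complex^'n^'n \<Rightarrow> complex^'n^'n" where
  "adjoint_matrix U = map_matrix cnj (transpose U)"

definition unitary_group :: "(complex^'n^'n) set" where
  "unitary_group = {U. adjoint_matrix U ** U = mat 1 \<and> U ** adjoint_matrix U = mat 1}"

text \<open>Derivatives on the closed unit interval are one-sided at the end points; the values of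
  functions outside the interval play no role.\<close>

definition deriv01 :: "(real \<Rightarrow> complex^'n) \<Rightarrow> real \<Rightarrow> complex^'n" where
  "deriv01 f t = vector_derivative f (at t within {0..1})"

definition smooth01 :: "(real \<Rightarrow> complex^'n) \<Rightarrow> bool" where
  "smooth01 f \<longleftrightarrow> (\<forall>k. \<forall>t\<in>{0..1}. (deriv01 ^^ k) f differentiable (at t within {0..1}))"

definition smooth_bc :: "complex^'n^'n \<Rightarrow> (real \<Rightarrow> complex^'n) set" where
  "smooth_bc U = {f. smooth01 f \<and> f 1 = U *v f 0}"

definition sobolev_norm :: "(real \<Rightarrow> complex^'n) \<Rightarrow> real" where
  "sobolev_norm f = sqrt (integral {0..1} (\<lambda>t. (norm (deriv01 f t))\<^sup>2 + (norm (f t))\<^sup>2))"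

text \<open>The completion of \<open>smooth_bc U\<close> in the Sobolev norm is realised inside \<open>L\<^sup>2\<close>: the
  inclusion is Sobolev-to-\<open>L\<^sup>2\<close> bounded, so a Sobolev-Cauchy sequence represents its \<open>L\<^sup>2\<close>-limit
  (and distinct elements of the completion have distinct limits).  The predicate
  \<open>sobolev_approx U \<phi> f\<close> says that the Cauchy sequence \<open>\<phi>\<close> represents \<open>f\<close>.\<close>

definition sobolev_approx ::
  "complex^'n^'n \<Rightarrow> (nat \<Rightarrow> real \<Rightarrow> complex^'n) \<Rightarrow> 'n L2 \<Rightarrow> bool" where
  "sobolev_approx U \<phi> f \<longleftrightarrow>
     (\<forall>k. \<phi> k \<in> smooth_bc U) \<and>
     (\<forall>e>0. \<exists>M. \<forall>m\<ge>M. \<forall>n\<ge>M. sobolev_norm (\<lambda>t. \<phi> m t - \<phi> n t) < e) \<and>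
     (\<lambda>k. L2_class (\<phi> k)) \<longlonglongrightarrow> f"

definition dom_T :: "complex^'n^'n \<Rightarrow> 'n L2 set" where
  "dom_T U = {f. \<exists>\<phi>. sobolev_approx U \<phi> f}"

text \<open>On the completion, \<open>-i d/dt\<close> is the extension by continuity of the derivative of smooth
  functions.\<close>

definition op_T :: "complex^'n^'n \<Rightarrow> 'n L2 \<Rightarrow> 'n L2" where
  "op_T U f = (THE g. \<exists>\<phi>. sobolev_approx U \<phi> f \<and>
     (\<lambda>k. L2_class (\<lambda>t. - \<i> *s deriv01 (\<phi> k) t)) \<longlonglongrightarrow> g)"

definition universal_family :: "complex^'n^'n \<Rightarrow> 'n Hhat set" where
  "universal_family U = {(op_T U f, f) | f. f \<in> dom_T U}"


section \<open>The inclusion given by the Arnold isomorphism\<close>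

definition arnold :: "complex^'n^'n \<Rightarrow> ((complex^'n) \<times> (complex^'n)) set" where
  "arnold U = {((mat 1 + U) *v v, - \<i> *s ((mat 1 - U) *v v)) | v. True}"

definition Wspace :: "'n::finite L2 set" where
  "Wspace = cortho (range const_L2)"

definition arnold_inclusion :: "complex^'n^'n \<Rightarrow> 'n Hhat set" where
  "arnold_inclusion U = {(const_L2 x + w, const_L2 y) | x y w. (x, y) \<in> arnold U \<and> w \<in> Wspace}"

end

theory Submission
  imports Defs
begin

text \<open>Write \<open>c\<close> for the inclusion of the constants, \<open>\<ell> h\<close> for the integral of \<open>h\<close> over \<open>[0,1]\<close> and \<open>S h\<close>
  for the primitive of \<open>h\<close> vanishing at \<open>0\<close>. For a unitary \<open>Q\<close> and \<open>0 \<le> r \<le> 1\<close> put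
  \<open>L(r, Q) = {(h, i (c (((1 - r) Q - 1) n) + r S h)) | \<ell> h = (1 + Q) n}\<close>. Then \<open>L(0, Q)\<close> is the Arnold
  lagrangian of \<open>Q\<close> and \<open>L(1, -U)\<close> is the graph of \<open>T_U\<close>, so that
  \<open>(s, U) \<mapsto> L(1 - s, e^{i \<pi> (1 - s)} U)\<close> is the homotopy. That \<open>L(r, Q)\<close> is lagrangian only uses
  that \<open>c\<close> and \<open>\<ell>\<close> are adjoint, \<open>\<ell> c = 1\<close> and \<open>S + S* = c \<ell>\<close> (integration by parts). The projections depend
  continuously on \<open>(r, Q)\<close> because \<open>L(r, Q)\<close> is the range of an operator that is bounded below and depends
  norm-continuously on \<open>(r, Q)\<close>.\<close>

section \<open>Orthogonal projections in complex Hilbert spaces\<close>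

text \<open>The two ends meet \<open>Hminus\<close> in different eigenspaces of \<open>U\<close>:
  the graph of \<open>T_U\<close> in the kernel of \<open>T_U\<close>, the constants fixed by
  \<open>U\<close>, and the Arnold lagrangian in the eigenspace for -1. This mismatch forces the
  half turn: all along the path the intersection with \<open>Hminus\<close> comes from the
  eigenvalue -1 of \<open>Q\<close>, and \<open>Q\<close> has to start at \<open>-U\<close> and end
  at \<open>U\<close>. When -1 is an eigenvalue of \<open>Q\<close>, the equation for the integral
  of \<open>h\<close> does not determine \<open>n\<close>, so no member of the family need be a
  graph over the first factor; the pair \<open>(h, n)\<close>, essentially derivative and initial
  value, is the parameter. In these terms the unbounded \<open>T_U\<close> is described by bounded
  operators only, and norm continuity of the projections becomes accessible. The factor
  \<open>r\<close> damps the primitive, the only part of the second component that leaves the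
  constants. At \<open>r = 0\<close> it is gone, and \<open>h\<close> is constrained by its mean
  alone; this freedom is the summand \<open>W\<close>.\<close>

lemma scaleC_minus_left: "(- c) *\<^sub>C x = - (c *\<^sub>C x)"
  by (rule complex_vector.scale_minus_left)

lemma scaleC_minus_right: "c *\<^sub>C (- x) = - (c *\<^sub>C x)"
  by (rule complex_vector.scale_minus_right)

lemma scaleC_diff_right: "c *\<^sub>C (x - y) = c *\<^sub>C x - c *\<^sub>C y"
  by (rule complex_vector.scale_right_diff_distrib)

lemma scaleC_scaleR: "c *\<^sub>C (r *\<^sub>R x) = r *\<^sub>R (c *\<^sub>C x)"
  by (simp add: scaleR_scaleC scaleC_scaleC mult.commute)

lemma cinner_add_right: "cinner x (y + z) = cinner x y + cinner x z"
  by (metis cinner_add_left cinner_commute complex_cnj_add)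

lemma cinner_scaleC_right: "cinner x (c *\<^sub>C y) = cnj c * cinner x y"
  by (metis cinner_scaleC_left cinner_commute complex_cnj_mult)

lemma cinner_scaleR_left: "cinner (r *\<^sub>R x) y = r *\<^sub>R cinner x y"
  by (simp add: scaleR_scaleC cinner_scaleC_left scaleR_conv_of_real)

lemma cinner_scaleR_right: "cinner x (r *\<^sub>R y) = r *\<^sub>R cinner x y"
  by (simp add: scaleR_scaleC cinner_scaleC_right scaleR_conv_of_real)

lemma cinner_minus_left [simp]: "cinner (- x) y = - cinner x y"
  using cinner_scaleR_left[of "-1" x y] by simp

lemma cinner_diff_left: "cinner (x - y) z = cinner x z - cinner y z"
  using cinner_add_left[of x "- y" z] by simp

text \<open>Im z = Re (-i z), and the second argument is conjugate linear. Through this identity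
  real Hilbert space arguments settle complex statements.\<close>

lemma cinner_eq_inner: "cinner x y = Complex (inner x y) (inner x (\<i> *\<^sub>C y))"
  by (simp add: complex_eq_iff inner_eq_Re_cinner cinner_scaleC_right)

lemma norm_scaleC: "norm (c *\<^sub>C (x :: 'a::complex_inner)) = cmod c * norm x"
proof -
  have "inner (c *\<^sub>C x) (c *\<^sub>C x) = Re ((c * cnj c) * cinner x x)"
    by (simp only: inner_eq_Re_cinner cinner_scaleC_left cinner_scaleC_right ac_simps)
  also have "\<dots> = (cmod c)\<^sup>2 * inner x x"
    by (simp only: complex_norm_square[symmetric] Re_complex_of_real inner_eq_Re_cinner
        of_real_mult[symmetric] times_complex.sel complex_of_real_def complex.sel mult_zero_left diff_zero)
  finally have "(norm (c *\<^sub>C x))\<^sup>2 = (cmod c * norm x)\<^sup>2"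
    by (simp only: power2_norm_eq_inner[symmetric] power_mult_distrib)
  then show ?thesis
    by (simp add: power2_eq_iff_nonneg)
qed

lemma bounded_linear_scaleC: "bounded_linear (\<lambda>x :: 'a::complex_inner. c *\<^sub>C x)"
  by (rule bounded_linear_intro[of _ "cmod c"])
    (simp_all add: scaleC_add_right scaleC_scaleR norm_scaleC mult.commute)

lemma bounded_bilinear_cinner: "bounded_bilinear (cinner :: 'a::complex_inner \<Rightarrow> 'a \<Rightarrow> complex)"
proof
  show "\<exists>K. \<forall>a b :: 'a. norm (cinner a b) \<le> norm a * norm b * K"
  proof (intro exI allI)
    fix a b :: 'a
    have "norm (cinner a b) \<le> \<bar>inner a b\<bar> + \<bar>inner a (\<i> *\<^sub>C b)\<bar>"
      by (metis cinner_eq_inner cmod_le complex.sel)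
    also have "\<dots> \<le> norm a * norm b + norm a * norm (\<i> *\<^sub>C b)"
      by (intro add_mono Cauchy_Schwarz_ineq2)
    finally show "norm (cinner a b) \<le> norm a * norm b * 2"
      by (simp add: norm_scaleC)
  qed
qed (simp_all add: cinner_add_left cinner_add_right cinner_scaleR_left cinner_scaleR_right)

lemma csubspace_imp_subspace:
  assumes "csubspace L"
  shows "subspace L"
  using assms unfolding subspace_def complex_vector.subspace_def
  by (simp add: scaleR_scaleC)

text \<open>A complex subspace contains \<open>\<i> *\<^sub>C y\<close> along with \<open>y\<close>,
  and real orthogonality to both kills the real and the imaginary part of
  \<open>cinner x y\<close>.\<close>

lemma cortho_iff_inner:
  assumes "csubspace L"
  shows "x \<in> cortho L \<longleftrightarrow> (\<forall>y\<in>L. inner x y = 0)"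
proof
  assume *: "\<forall>y\<in>L. inner x y = 0"
  have "\<i> *\<^sub>C y \<in> L" if "y \<in> L" for y
    using assms that by (rule complex_vector.subspace_scale)
  with * show "x \<in> cortho L"
    by (simp add: cortho_def cinner_eq_inner complex_eq_iff)
qed (simp add: cortho_def inner_eq_Re_cinner)

lemma closed_cortho: "closed (cortho L)"
proof -
  have "continuous_on UNIV (\<lambda>x. cinner x y)" for y :: 'a
    by (intro linear_continuous_on bounded_bilinear.bounded_linear_left[OF bounded_bilinear_cinner])
  moreover have "cortho L = (\<Inter>y\<in>L. (\<lambda>x. cinner x y) -` {0})"
    by (auto simp: cortho_def)
  ultimately show ?thesis
    by (auto intro!: closed_INT simp: continuous_on_closed_vimage)
qed

text \<open>The nearest point of \<open>L\<close> to \<open>x\<close>: a minimizing sequence is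
  Cauchy by the parallelogram law, and varying its limit along \<open>z\<close> gives
  orthogonality.\<close>

lemma orthogonal_decomposition:
  fixes L :: "'a::{real_inner, complete_space} set"
  assumes L: "subspace L" "closed L"
  obtains y where "y \<in> L" "\<And>z. z \<in> L \<Longrightarrow> inner (x - y) z = 0"
proof -
  define d where "d = (INF y\<in>L. norm (x - y))"
  have ne: "L \<noteq> {}"
    using L(1) subspace_0 by blast
  have d_le: "d \<le> norm (x - y)" if "y \<in> L" for y
    unfolding d_def by (rule cINF_lower[OF _ that]) (auto intro: bdd_belowI[of _ 0])
  have d_ge: "0 \<le> d"
    unfolding d_def by (rule cINF_greatest[OF ne]) simp
  have "\<exists>y\<in>L. norm (x - y) < d + inverse (Suc n)" for n
    using cInf_lessD[of "(\<lambda>y. norm (x - y)) ` L" "d + inverse (Suc n)"] ne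
    unfolding d_def by auto
  then obtain u where u: "\<And>n. u n \<in> L" "\<And>n. norm (x - u n) < d + inverse (Suc n)"
    by metis
  have bound: "(norm (u m - u n))\<^sup>2 \<le> 4 * (2 * d * inverse (Suc k) + (inverse (Suc k))\<^sup>2)"
    if "k \<le> m" "k \<le> n" for k m n
  proof -
    have sq: "(norm (x - u j))\<^sup>2 \<le> (d + inverse (Suc k))\<^sup>2" if "k \<le> j" for j
    proof (rule power_mono)
      have "inverse (real (Suc j)) \<le> inverse (Suc k)"
        using that by (simp add: field_simps)
      with u(2)[of j] show "norm (x - u j) \<le> d + inverse (Suc k)" by linarith
    qed simp
    \<comment> \<open>The midpoint lies in \<open>L\<close> and so has distance at least
      \<open>d\<close> from \<open>x\<close>. The parallelogram law for \<open>x - u m\<close> and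
      \<open>x - u n\<close> turns this into a bound on \<open>u m - u n\<close>.\<close>
    have "(1/2) *\<^sub>R (u m + u n) \<in> L"
      using u(1) L(1) by (simp add: subspace_add subspace_scale)
    then have "d\<^sup>2 \<le> (norm (x - (1/2) *\<^sub>R (u m + u n)))\<^sup>2"
      using d_le d_ge by (intro power_mono) auto
    moreover have "(norm (u m - u n))\<^sup>2 = 2 * (norm (x - u m))\<^sup>2 + 2 * (norm (x - u n))\<^sup>2
        - 4 * (norm (x - (1/2) *\<^sub>R (u m + u n)))\<^sup>2"
      by (simp add: power2_norm_eq_inner inner_diff_left inner_diff_right inner_add_left
          inner_add_right inner_commute algebra_simps)
    ultimately show ?thesis
      using sq[OF that(1)] sq[OF that(2)] by (simp add: power2_sum algebra_simps)
  qed
  have lim: "(\<lambda>k. 4 * (2 * d * inverse (real (Suc k)) + (inverse (real (Suc k)))\<^sup>2)) \<longlonglongrightarrow> 4 * (2 * d * 0 + 0\<^sup>2)"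
    by (intro tendsto_intros LIMSEQ_inverse_real_of_nat)
  have "Cauchy u"
  proof (rule metric_CauchyI)
    fix e :: real assume e: "e > 0"
    then obtain k where k: "4 * (2 * d * inverse (real (Suc k)) + (inverse (real (Suc k)))\<^sup>2) < e\<^sup>2"
      using order_tendstoD(2)[OF lim, of "e\<^sup>2"] by (auto simp: eventually_sequentially)
    have "dist (u m) (u n) < e" if "m \<ge> k" "n \<ge> k" for m n
      using bound[OF that] k e by (simp add: dist_norm power2_less_imp_less)
    then show "\<exists>M. \<forall>m\<ge>M. \<forall>n\<ge>M. dist (u m) (u n) < e" by blast
  qed
  then obtain y where y: "u \<longlonglongrightarrow> y"
    using Cauchy_convergent convergent_def by blast
  have yL: "y \<in> L"
    using closed_sequentially[OF L(2) u(1) y] .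
  have "norm (x - y) \<le> d"
  proof (rule LIMSEQ_le)
    show "(\<lambda>n. norm (x - u n)) \<longlonglongrightarrow> norm (x - y)"
      using y by (intro tendsto_intros)
    show "(\<lambda>n. d + inverse (real (Suc n))) \<longlonglongrightarrow> d"
      using LIMSEQ_inverse_real_of_nat_add .
    show "\<exists>N. \<forall>n\<ge>N. norm (x - u n) \<le> d + inverse (real (Suc n))"
      using u(2) less_imp_le by blast
  qed
  have "inner (x - y) z = 0" if z: "z \<in> L" for z
  proof (cases "z = 0")
    case False
    define a where "a = inner (x - y) z"
    \<comment> \<open>The minimizer of the distance from \<open>x - y\<close> to the multiples of
      \<open>z\<close>. Minimality of \<open>y\<close> then says 2 a^2 \<le> a^2, up to the positive
      factor 1 / |z|^2.\<close>
    define t where "t = a / (norm z)\<^sup>2"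
    have "norm (x - y) \<le> norm (x - (y + t *\<^sub>R z))"
      using \<open>norm (x - y) \<le> d\<close> d_le[of "y + t *\<^sub>R z"] L(1) yL z
      by (meson order_trans subspace_add subspace_scale)
    then have "(norm (x - y))\<^sup>2 \<le> (norm ((x - y) - t *\<^sub>R z))\<^sup>2"
      by (intro power_mono) (simp_all add: algebra_simps)
    then have "2 * t * a \<le> t\<^sup>2 * (norm z)\<^sup>2"
      unfolding a_def power2_norm_eq_inner inner_diff_left[of "x - y" "t *\<^sub>R z"]
        inner_diff_right[of _ "x - y" "t *\<^sub>R z"]
      by (simp add: inner_commute power2_eq_square)
    then have "a\<^sup>2 \<le> 0"
      using False by (simp add: t_def field_simps power2_eq_square)
    then show ?thesis by (simp add: a_def)
  qed simp
  with yL show thesis by (rule that)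
qed

text \<open>\<open>ortho_proj\<close> is a definite description, so a bounded operator with the
  defining property has to be exhibited. Linearity of the nearest point map comes from uniqueness of
  the decomposition, and the bound 1 from Cauchy-Schwarz.\<close>

lemma ortho_proj_eqs:
  fixes L :: "'a::{complex_inner, complete_space} set"
  assumes L: "csubspace L" "closed L"
  shows ortho_proj_in: "blinfun_apply (ortho_proj L) x \<in> L"
    and ortho_proj_compl: "x - blinfun_apply (ortho_proj L) x \<in> cortho L"
proof -
  have sL: "subspace L" by (rule csubspace_imp_subspace[OF L(1)])
  have "\<exists>y. y \<in> L \<and> (\<forall>z\<in>L. inner (x - y) z = 0)" for x
    using orthogonal_decomposition[OF sL L(2)] by metis
  then obtain p where p: "\<And>x. p x \<in> L" "\<And>x z. z \<in> L \<Longrightarrow> inner (x - p x) z = 0"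
    by metis
  have uniq: "y = p x" if "y \<in> L" "\<And>z. z \<in> L \<Longrightarrow> inner (x - y) z = 0" for x y
  proof -
    have "y - p x \<in> L"
      using that(1) p(1) sL by (simp add: subspace_diff)
    then have "inner (x - p x) (y - p x) - inner (x - y) (y - p x) = 0"
      using p(2) that(2) by simp
    then show ?thesis
      by (simp add: inner_diff_left[symmetric])
  qed
  have "bounded_linear p"
  proof (rule bounded_linear_intro[of _ 1])
    show "p (x + y) = p x + p y" for x y
      using p sL by (intro uniq[symmetric])
        (simp_all add: subspace_add add_diff_add inner_add_left)
    show "p (r *\<^sub>R x) = r *\<^sub>R p x" for r x
      using p sL by (intro uniq[symmetric])
        (simp_all add: subspace_scale scaleR_diff_right[symmetric])
    show "norm (p x) \<le> norm x * 1" for x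
    proof -
      have "inner (p x) (p x) = inner x (p x)"
        using p(2)[OF p(1), of x x] by (simp add: inner_diff_left)
      also have "\<dots> \<le> norm x * norm (p x)"
        by (rule norm_cauchy_schwarz)
      finally have "norm (p x) * norm (p x) \<le> norm x * norm (p x)"
        by (simp add: power2_norm_eq_inner[symmetric] power2_eq_square)
      then show ?thesis
        by (cases "p x = 0") auto
    qed
  qed
  then have app: "blinfun_apply (Blinfun p) = p"
    by (rule bounded_linear_Blinfun_apply)
  have "\<forall>x. blinfun_apply (ortho_proj L) x \<in> L \<and> x - blinfun_apply (ortho_proj L) x \<in> cortho L"
    unfolding ortho_proj_def
  proof (rule theI[of _ "Blinfun p"])
    show "\<forall>x. blinfun_apply (Blinfun p) x \<in> L \<and> x - blinfun_apply (Blinfun p) x \<in> cortho L"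
      using p by (simp add: app cortho_iff_inner[OF L(1)])
    show "P = Blinfun p" if "\<forall>x. blinfun_apply P x \<in> L \<and> x - blinfun_apply P x \<in> cortho L" for P
      using that by (intro blinfun_eqI) (simp add: app uniq cortho_iff_inner[OF L(1)])
  qed
  then show "blinfun_apply (ortho_proj L) x \<in> L" "x - blinfun_apply (ortho_proj L) x \<in> cortho L"
    by auto
qed

section \<open>Gap between subspaces and norm distance of projections\<close>

lemma norm_le_of_orthogonal_sum:
  fixes x y :: "'a::real_inner"
  assumes "inner (x - y) y = 0"
  shows "norm y \<le> norm x" "norm (x - y) \<le> norm x"
proof -
  have "(norm x)\<^sup>2 = (norm y)\<^sup>2 + (norm (x - y))\<^sup>2"
    using assms by (simp add: power2_norm_eq_inner inner_diff_left inner_diff_right inner_commute)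
  then show "norm y \<le> norm x" "norm (x - y) \<le> norm x"
    by (auto intro: power2_le_imp_le)
qed

text \<open>For two projections \<open>P\<close>, \<open>Q\<close> one has \<open>P - Q = (1 - Q) P - Q (1 - P)\<close>, and the second term is
  the adjoint of \<open>(1 - P) Q\<close>.\<close>

lemma norm_ortho_proj_diff_le:
  fixes L M :: "'a::{complex_inner, complete_space} set"
  assumes L: "csubspace L" "closed L" and M: "csubspace M" "closed M"
    and L_near: "\<And>x. x \<in> L \<Longrightarrow> \<exists>y\<in>M. norm (x - y) \<le> \<delta> * norm x"
    and M_near: "\<And>x. x \<in> M \<Longrightarrow> \<exists>y\<in>L. norm (x - y) \<le> \<delta> * norm x"
    and "0 \<le> \<delta>"
  shows "norm (ortho_proj L - ortho_proj M) \<le> 2 * \<delta>"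
proof (rule norm_blinfun_bound)
  fix x :: 'a
  define P where "P = blinfun_apply (ortho_proj L)"
  define Q where "Q = blinfun_apply (ortho_proj M)"
  have P: "P x \<in> L" "\<And>z. z \<in> L \<Longrightarrow> inner (x - P x) z = 0" for x
    using ortho_proj_in[OF L] ortho_proj_compl[OF L] unfolding P_def
    by (auto simp: cortho_iff_inner[OF L(1)])
  have Q: "Q x \<in> M" "\<And>z. z \<in> M \<Longrightarrow> inner (x - Q x) z = 0" for x
    using ortho_proj_in[OF M] ortho_proj_compl[OF M] unfolding Q_def
    by (auto simp: cortho_iff_inner[OF M(1)])
  \<comment> \<open>An orthogonal projection picks the nearest point, so it does at least as well as
    the approximant supplied by the hypothesis.\<close>
  have near: "norm (z - R z) \<le> \<delta> * norm z"
    if R: "R z \<in> K" "\<And>w. w \<in> K \<Longrightarrow> inner (z - R z) w = 0"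
      and K: "subspace K" "\<exists>y\<in>K. norm (z - y) \<le> \<delta> * norm z" for K and R :: "'a \<Rightarrow> 'a" and z
  proof -
    obtain y where y: "y \<in> K" "norm (z - y) \<le> \<delta> * norm z" using K by blast
    have "R z - y \<in> K" using R(1) y(1) K(1) by (simp add: subspace_diff)
    then have "norm ((z - y) - (R z - y)) \<le> norm (z - y)"
      using R(2) by (intro norm_le_of_orthogonal_sum) simp
    with y(2) show ?thesis by simp
  qed
  have P_le: "norm (P x) \<le> norm x" and P_le': "norm (x - P x) \<le> norm x"
    using norm_le_of_orthogonal_sum[OF P(2)[OF P(1)]] by auto
  have "norm (P x - Q (P x)) \<le> \<delta> * norm (P x)"
    by (rule near[where R = Q, OF Q(1) Q(2) csubspace_imp_subspace[OF M(1)] L_near[OF P(1)]])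
  also have "\<dots> \<le> \<delta> * norm x"
    using P_le \<open>0 \<le> \<delta>\<close> by (rule mult_left_mono)
  finally have 1: "norm (P x - Q (P x)) \<le> \<delta> * norm x" .
  define v where "v = Q (x - P x)"
  have v: "v \<in> M" by (simp add: v_def Q)
  have "norm v * norm v = inner (x - P x) v"
    using Q(2)[OF v, of "x - P x"]
    by (simp add: v_def inner_diff_left power2_norm_eq_inner[symmetric] power2_eq_square)
  \<comment> \<open>\<open>x - P x\<close> is orthogonal to \<open>L\<close>, so \<open>P v\<close>
    may be subtracted for free. What remains is the distance of \<open>v\<close>, an element of
    \<open>M\<close>, from \<open>L\<close>.\<close>
  also have "\<dots> = inner (x - P x) (v - P v)"
    using P by (simp add: inner_diff_right)
  also have "\<dots> \<le> norm (x - P x) * norm (v - P v)"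
    by (rule norm_cauchy_schwarz)
  also have "\<dots> \<le> norm x * (\<delta> * norm v)"
    by (intro mult_mono P_le' near[where R = P, OF P(1) P(2) csubspace_imp_subspace[OF L(1)] M_near[OF v]]) auto
  finally have "norm v * norm v \<le> (\<delta> * norm x) * norm v"
    by (simp add: mult_ac)
  then have 2: "norm v \<le> \<delta> * norm x"
    using \<open>0 \<le> \<delta>\<close> by (cases "v = 0") auto
  have "P x - Q x = (P x - Q (P x)) - v"
    by (simp add: v_def Q_def blinfun.diff_right)
  then have "norm (P x - Q x) \<le> \<delta> * norm x + \<delta> * norm x"
    using 1 2 norm_triangle_ineq4[of "P x - Q (P x)" v] by (metis add_mono order_trans)
  then show "norm (blinfun_apply (ortho_proj L - ortho_proj M) x) \<le> 2 * \<delta> * norm x"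
    by (simp add: P_def Q_def blinfun.diff_left)
qed (use \<open>0 \<le> \<delta>\<close> in simp)

text \<open>A lower bound for \<open>\<Phi> p\<close> survives, with twice the constant, under small
  perturbations in norm. Matching the images of the same \<open>z\<close> under
  \<open>\<Phi> q\<close> and \<open>\<Phi> p\<close> then bounds the gap between the two ranges
  relative to the size of the image. The constant \<open>K\<close> may vary with
  \<open>p\<close>.\<close>

lemma continuous_on_ortho_proj_range:
  fixes \<Phi> :: "'p::metric_space \<Rightarrow> 'a::real_normed_vector \<Rightarrow>\<^sub>L 'b::{complex_inner, complete_space}"
  assumes cont: "continuous_on S \<Phi>"
    and range: "\<And>p. p \<in> S \<Longrightarrow> csubspace (range (blinfun_apply (\<Phi> p)))"
      "\<And>p. p \<in> S \<Longrightarrow> closed (range (blinfun_apply (\<Phi> p)))"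
    and below: "\<And>p. p \<in> S \<Longrightarrow> \<exists>K. \<forall>z. norm z \<le> K * norm (blinfun_apply (\<Phi> p) z)"
  shows "continuous_on S (\<lambda>p. ortho_proj (range (blinfun_apply (\<Phi> p))))"
  unfolding continuous_on_iff
proof (intro ballI allI impI)
  fix p and e :: real assume p: "p \<in> S" and e: "e > 0"
  obtain K where K: "\<And>z. norm z \<le> K * norm (blinfun_apply (\<Phi> p) z)"
    using below[OF p] by blast
  define C where "C = max K 1"
  have C: "C \<ge> 1" "norm z \<le> C * norm (blinfun_apply (\<Phi> p) z)" for z
    using K[of z] mult_right_mono[of K C "norm (blinfun_apply (\<Phi> p) z)"]
    by (auto simp: C_def intro: order_trans)
  \<comment> \<open>The first bound preserves the lower bound at nearby \<open>q\<close>, with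
    \<open>2 * C\<close> in place of \<open>C\<close>. The second makes the final estimate
    \<open>4 * C * \<epsilon>\<close> at most half of \<open>e\<close>.\<close>
  define \<epsilon> where "\<epsilon> = min (1 / (2 * C)) (e / (8 * C))"
  have \<epsilon>: "\<epsilon> > 0" "2 * C * \<epsilon> \<le> 1" "8 * C * \<epsilon> \<le> e"
    using C(1) e by (auto simp: \<epsilon>_def min_def field_simps)
  obtain d where d: "d > 0" "\<And>q. q \<in> S \<Longrightarrow> dist q p < d \<Longrightarrow> dist (\<Phi> q) (\<Phi> p) < \<epsilon>"
    using cont p \<epsilon>(1) unfolding continuous_on_iff by metis
  have "dist (ortho_proj (range (blinfun_apply (\<Phi> q)))) (ortho_proj (range (blinfun_apply (\<Phi> p)))) < e"
    if q: "q \<in> S" "dist q p < d" for q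
  proof -
    have diff: "norm (blinfun_apply (\<Phi> q) z - blinfun_apply (\<Phi> p) z) \<le> \<epsilon> * norm z" for z
    proof -
      have "norm (blinfun_apply (\<Phi> q - \<Phi> p) z) \<le> norm (\<Phi> q - \<Phi> p) * norm z"
        by (rule norm_blinfun)
      also have "\<dots> \<le> \<epsilon> * norm z"
        using d(2)[OF q] by (intro mult_right_mono) (auto simp: dist_norm)
      finally show ?thesis by (simp add: blinfun.diff_left)
    qed
    have q_below: "norm z \<le> 2 * C * norm (blinfun_apply (\<Phi> q) z)" for z
    proof -
      have "norm (blinfun_apply (\<Phi> p) z) \<le> norm (blinfun_apply (\<Phi> q) z) + \<epsilon> * norm z"
        using diff[of z] norm_triangle_sub[of "blinfun_apply (\<Phi> p) z" "blinfun_apply (\<Phi> q) z"]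
        by (simp add: norm_minus_commute)
      then have "C * norm (blinfun_apply (\<Phi> p) z) \<le> C * (norm (blinfun_apply (\<Phi> q) z) + \<epsilon> * norm z)"
        using C(1) by (intro mult_left_mono) auto
      moreover have "2 * C * \<epsilon> * norm z \<le> 1 * norm z"
        using \<epsilon>(2) by (rule mult_right_mono) simp
      ultimately show ?thesis
        using C(2)[of z] by (simp add: algebra_simps)
    qed
    have p_below: "norm z \<le> 2 * C * norm (blinfun_apply (\<Phi> p) z)" for z
      by (intro order_trans[OF C(2)] mult_right_mono) (use C(1) in auto)
    have "norm (ortho_proj (range (blinfun_apply (\<Phi> q))) - ortho_proj (range (blinfun_apply (\<Phi> p))))
        \<le> 2 * (2 * C * \<epsilon>)"
    proof (rule norm_ortho_proj_diff_le)
      have gap: "norm (blinfun_apply (\<Phi> q) z - blinfun_apply (\<Phi> p) z) \<le> 2 * C * \<epsilon> * b"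
        if "norm z \<le> 2 * C * b" for z b
      proof -
        have "\<epsilon> * norm z \<le> \<epsilon> * (2 * C * b)"
          using that \<epsilon>(1) by (intro mult_left_mono) auto
        then show ?thesis
          using diff[of z] by (simp only: mult.assoc mult.left_commute)
      qed
      show "\<exists>y\<in>range (blinfun_apply (\<Phi> p)). norm (x - y) \<le> 2 * C * \<epsilon> * norm x"
        if "x \<in> range (blinfun_apply (\<Phi> q))" for x
        using that gap[OF q_below] by auto
      show "\<exists>y\<in>range (blinfun_apply (\<Phi> q)). norm (x - y) \<le> 2 * C * \<epsilon> * norm x"
        if "x \<in> range (blinfun_apply (\<Phi> p))" for x
        using that gap[OF p_below] by (auto simp: norm_minus_commute)
    qed (use range p q \<epsilon> C in auto)
    also have "\<dots> < e"
      using \<epsilon>(3) e by linarith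
    finally show ?thesis by (simp add: dist_norm)
  qed
  with d(1) show "\<exists>d>0. \<forall>q\<in>S. dist q p < d \<longrightarrow>
      dist (ortho_proj (range (blinfun_apply (\<Phi> q)))) (ortho_proj (range (blinfun_apply (\<Phi> p)))) < e"
    by blast
qed


section \<open>Completeness of \<open>L\<^sup>2\<close> and density of polynomials\<close>

lemma L2_rel_refl: "L2_rel f f \<longleftrightarrow> square_integrable f"
  by (simp add: L2_rel_def)

lemma square_integrable_rep_L2 [simp]: "square_integrable (rep_L2 x)"
  using Quotient3_rep_reflp[OF Quotient3_L2, of x] by (simp add: L2_rel_refl)

lemma L2_class_rep_L2 [simp]: "L2_class (rep_L2 x) = x"
  unfolding L2_class_def by (rule Quotient3_abs_rep[OF Quotient3_L2])

lemma L2_class_eq_iff: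
  assumes "square_integrable f" "square_integrable g"
  shows "L2_class f = L2_class g \<longleftrightarrow> (AE t in unit_measure. f t = g t)"
  using Quotient3_rel[OF Quotient3_L2, of f g] assms by (simp add: L2_class_def L2_rel_def)

lemma rep_L2_class:
  assumes "square_integrable f"
  shows "AE t in unit_measure. rep_L2 (L2_class f) t = f t"
  using assms by (simp add: L2_class_eq_iff[symmetric])

lemma L2_class_cong:
  assumes "\<And>t. t \<in> {0..1} \<Longrightarrow> f t = g t" "square_integrable f"
  shows "square_integrable g" "L2_class f = L2_class g"
proof -
  have "f \<in> borel_measurable unit_measure \<longleftrightarrow> g \<in> borel_measurable unit_measure"
    by (rule measurable_cong) (simp add: assms)
  moreover have "integrable unit_measure (\<lambda>t. (norm (f t))\<^sup>2) \<longleftrightarrow> integrable unit_measure (\<lambda>t. (norm (g t))\<^sup>2)"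
    by (rule Bochner_Integration.integrable_cong) (simp_all add: assms)
  ultimately show "square_integrable g"
    using assms(2) by (simp add: square_integrable_def)
  then show "L2_class f = L2_class g"
    using assms by (subst L2_class_eq_iff) (auto intro!: AE_I2)
qed

lemma square_integrable_minus: "square_integrable f \<Longrightarrow> square_integrable (\<lambda>t. - f t)"
  using square_integrable_scaleR[of f "-1"] by simp

lemma square_integrable_diff:
  "square_integrable f \<Longrightarrow> square_integrable g \<Longrightarrow> square_integrable (\<lambda>t. f t - g t)"
  using square_integrable_add[OF _ square_integrable_minus, of f g] by simp

lemma L2_class_add:
  "square_integrable f \<Longrightarrow> square_integrable g \<Longrightarrow> L2_class (\<lambda>t. f t + g t) = L2_class f + L2_class g"
  by (simp add: L2_class_def plus_L2.abs_eq L2_rel_refl)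

lemma L2_class_scaleC: "square_integrable f \<Longrightarrow> L2_class (\<lambda>t. c *s f t) = c *\<^sub>C L2_class f"
  by (simp add: L2_class_def scaleC_L2.abs_eq L2_rel_refl)

lemma L2_class_diff:
  "square_integrable f \<Longrightarrow> square_integrable g \<Longrightarrow> L2_class (\<lambda>t. f t - g t) = L2_class f - L2_class g"
  by (simp add: L2_class_def minus_L2_def plus_L2.abs_eq uminus_L2.abs_eq L2_rel_refl square_integrable_minus)

lemma norm_L2_class:
  assumes "square_integrable f"
  shows "(norm (L2_class f))\<^sup>2 = integral\<^sup>L unit_measure (\<lambda>t. (norm (f t))\<^sup>2)"
  using assms by (simp add: L2_class_def power2_norm_eq_inner inner_L2.abs_eq L2_rel_refl)

lemma cinner_L2_class:
  assumes "square_integrable f" "square_integrable g"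
  shows "cinner (L2_class f) (L2_class g) = integral\<^sup>L unit_measure (\<lambda>t. vec_cinner (f t) (g t))"
  using assms by (simp add: L2_class_def cinner_L2.abs_eq L2_rel_refl)

lemma finite_measure_unit: "finite_measure unit_measure"
  by (intro finite_measureI) (simp add: space_restrict_space emeasure_restrict_space)

lemma measure_unit [simp]: "measure unit_measure {0..1} = 1"
  by (simp add: measure_restrict_space)

lemma integrable_unit_const [simp]: "integrable unit_measure (\<lambda>_. c)"
  by (rule finite_measure.integrable_const[OF finite_measure_unit])

lemma integrable_square_integrable:
  assumes "square_integrable f"
  shows "integrable unit_measure f"
proof (rule Bochner_Integration.integrable_bound)
  show "integrable unit_measure (\<lambda>t. 1 + (norm (f t))\<^sup>2)"
    using assms by (auto simp: square_integrable_def)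
  have "a \<le> 1 + a\<^sup>2" for a :: real
    using sum_squares_bound[of a 1] zero_le_power2[of a] by (simp; linarith)
  then show "AE t in unit_measure. norm (f t) \<le> norm (1 + (norm (f t))\<^sup>2)"
    by simp
qed (use assms in \<open>simp add: square_integrable_def\<close>)

text \<open>The variance of the function \<open>|f|\<close> is nonnegative.\<close>

lemma integral_norm_le_L2:
  assumes "square_integrable f"
  shows "integral\<^sup>L unit_measure (\<lambda>t. norm (f t)) \<le> norm (L2_class f)"
proof -
  define m where "m = integral\<^sup>L unit_measure (\<lambda>t. norm (f t))"
  have int: "integrable unit_measure (\<lambda>t. norm (f t))" "integrable unit_measure (\<lambda>t. (norm (f t))\<^sup>2)"
    using integrable_square_integrable[OF assms] assms by (auto simp: square_integrable_def)
  have "0 \<le> integral\<^sup>L unit_measure (\<lambda>t. (norm (f t) - m)\<^sup>2)"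
    by (rule integral_nonneg_AE) simp
  also have "\<dots> = integral\<^sup>L unit_measure (\<lambda>t. (norm (f t))\<^sup>2 - 2 * m * norm (f t) + m\<^sup>2)"
    by (rule arg_cong[of _ _ "integral\<^sup>L unit_measure"]) (auto simp: power2_diff)
  also have "\<dots> = integral\<^sup>L unit_measure (\<lambda>t. (norm (f t))\<^sup>2) - 2 * m * m + m\<^sup>2"
    using int by (simp add: m_def)
  finally have "m\<^sup>2 \<le> (norm (L2_class f))\<^sup>2"
    by (simp only: norm_L2_class[OF assms]) (simp add: power2_eq_square)
  then show ?thesis
    unfolding m_def by (rule power2_le_imp_le) simp
qed

lemma norm_L2_class_le:
  assumes "square_integrable f" "\<And>t. t \<in> {0..1} \<Longrightarrow> norm (f t) \<le> B"
  shows "norm (L2_class f) \<le> B"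
proof (rule power2_le_imp_le)
  show B: "0 \<le> B"
    using order_trans[OF norm_ge_zero assms(2)[of 0]] by simp
  have "integral\<^sup>L unit_measure (\<lambda>t. (norm (f t))\<^sup>2) \<le> integral\<^sup>L unit_measure (\<lambda>t. B\<^sup>2)"
    using assms by (intro integral_mono) (auto simp: square_integrable_def intro!: power_mono)
  then show "(norm (L2_class f))\<^sup>2 \<le> B\<^sup>2"
    by (simp add: norm_L2_class[OF assms(1)])
qed

text \<open>Dominated convergence is applied to the squared errors, which is why \<open>w\<close>
  bounds these and not the functions; a square root gives back the norm.\<close>

lemma L2_class_dominated_tendsto:
  assumes f: "\<And>n. square_integrable (f n)" "square_integrable g"
    and w: "integrable unit_measure w" "\<And>n t. t \<in> {0..1} \<Longrightarrow> (norm (f n t - g t))\<^sup>2 \<le> w t"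
    and lim: "AE t in unit_measure. (\<lambda>n. f n t) \<longlonglongrightarrow> g t"
  shows "(\<lambda>n. L2_class (f n)) \<longlonglongrightarrow> L2_class g"
proof -
  have d: "square_integrable (\<lambda>t. f n t - g t)" for n
    using f by (simp add: square_integrable_diff)
  have "(\<lambda>n. integral\<^sup>L unit_measure (\<lambda>t. (norm (f n t - g t))\<^sup>2)) \<longlonglongrightarrow> integral\<^sup>L unit_measure (\<lambda>t. 0)"
  proof (rule integral_dominated_convergence[OF _ _ w(1)])
    show "AE t in unit_measure. (\<lambda>n. (norm (f n t - g t))\<^sup>2) \<longlonglongrightarrow> 0"
      using lim
    proof eventually_elim
      case (elim t)
      then have "(\<lambda>n. norm (f n t - g t)) \<longlonglongrightarrow> 0"
        using LIM_zero tendsto_norm_zero by blast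
      from tendsto_power[OF this, of 2] show ?case by simp
    qed
    show "AE t in unit_measure. norm ((norm (f n t - g t))\<^sup>2) \<le> w t" for n
      using w(2) by (intro AE_I2) simp
  qed (use d in \<open>auto simp: square_integrable_def\<close>)
  then have "(\<lambda>n. (norm (L2_class (f n) - L2_class g))\<^sup>2) \<longlonglongrightarrow> 0"
    using norm_L2_class[OF d] f by (simp add: L2_class_diff)
  from tendsto_real_sqrt[OF this] show ?thesis
    by (simp add: LIM_zero_iff tendsto_norm_zero_iff)
qed

text \<open>Riesz-Fischer: a rapidly Cauchy subsequence converges almost everywhere, and Fatou's
  lemma compares the whole sequence with the pointwise limit.\<close>

instance L2 :: (finite) complete_space
proof
  fix X :: "nat \<Rightarrow> 'a L2"
  assume "Cauchy X"
  then have "\<forall>k. \<exists>M. \<forall>m\<ge>M. \<forall>n\<ge>M. norm (X m - X n) < (1/2) ^ k"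
    unfolding Cauchy_def dist_norm by simp
  then obtain M where M: "\<And>k m n. m \<ge> M k \<Longrightarrow> n \<ge> M k \<Longrightarrow> norm (X m - X n) < (1/2) ^ k"
    by metis
  \<comment> \<open>The partial sum dominates every \<open>M i\<close> with
    \<open>i \<le> k\<close>, so one index serves all earlier tolerances, whether or not
    \<open>M\<close> is monotone.\<close>
  define r where "r k = (\<Sum>i\<le>k. M i)" for k
  have r: "M i \<le> r k" if "i \<le> k" for i k
    unfolding r_def using that by (intro member_le_sum) auto
  define f where "f n = rep_L2 (X n)" for n
  have f: "square_integrable (f n)" "L2_class (f n) = X n" for n
    by (simp_all add: f_def)
  have fm [measurable]: "f n \<in> borel_measurable unit_measure" for n
    using f(1) by (simp add: square_integrable_def)
  define g where "g k = f (r k)" for k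
  have gm [measurable]: "g k \<in> borel_measurable unit_measure" for k
    by (simp add: g_def)
  have sq_nn: "(\<integral>\<^sup>+ t. ennreal ((norm (f m t - f n t))\<^sup>2) \<partial>unit_measure) = ennreal ((norm (X m - X n))\<^sup>2)" for m n
  proof -
    have d: "square_integrable (\<lambda>t. f m t - f n t)"
      by (simp add: f square_integrable_diff)
    then show ?thesis
      using norm_L2_class[OF d] f
      by (subst nn_integral_eq_integral) (auto simp: square_integrable_def L2_class_diff)
  qed
  define D where "D k t = norm (g (Suc k) t - g k t)" for k t
  have D_le: "(\<integral>\<^sup>+ t. ennreal (D k t) \<partial>unit_measure) \<le> ennreal ((1/2) ^ k)" for k
  proof -
    have d: "square_integrable (\<lambda>t. g (Suc k) t - g k t)"
      by (simp add: g_def f square_integrable_diff)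
    have "(\<integral>\<^sup>+ t. ennreal (D k t) \<partial>unit_measure) = ennreal (integral\<^sup>L unit_measure (D k))"
      unfolding D_def using integrable_square_integrable[OF d]
      by (intro nn_integral_eq_integral) auto
    also have "integral\<^sup>L unit_measure (D k) \<le> norm (X (r (Suc k)) - X (r k))"
      using integral_norm_le_L2[OF d] f by (simp add: D_def[abs_def] g_def L2_class_diff)
    also have "\<dots> \<le> (1/2) ^ k"
      using M[of k "r (Suc k)" "r k"] r[of k k] r[of k "Suc k"] by simp
    finally show ?thesis by (simp add: ennreal_leI)
  qed
  \<comment> \<open>The interval has measure 1, so the mean of each jump is at most its L2 norm. The
    total length of the jumps thus has finite integral and is finite almost everywhere, where
    \<open>g\<close> telescopes to a convergent sequence.\<close>
  have "(\<integral>\<^sup>+ t. (\<Sum>k. ennreal (D k t)) \<partial>unit_measure) = (\<Sum>k. \<integral>\<^sup>+ t. ennreal (D k t) \<partial>unit_measure)"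
    by (rule nn_integral_suminf) (simp add: D_def)
  also have "\<dots> \<le> (\<Sum>k. ennreal ((1/2) ^ k))"
    by (intro suminf_le D_le) auto
  also have "\<dots> = ennreal (\<Sum>k. (1/2) ^ k)"
    by (rule suminf_ennreal2) (auto intro: summable_geometric)
  finally have "(\<integral>\<^sup>+ t. (\<Sum>k. ennreal (D k t)) \<partial>unit_measure) \<noteq> \<infinity>"
    by (auto simp: top_unique)
  then have "AE t in unit_measure. (\<Sum>k. ennreal (D k t)) \<noteq> \<infinity>"
    by (intro nn_integral_PInf_AE) (auto simp: D_def)
  then have lim: "AE t in unit_measure. (\<lambda>k. g k t) \<longlonglongrightarrow> lim (\<lambda>k. g k t)"
  proof eventually_elim
    case (elim t)
    then have "summable (\<lambda>k. D k t)"
      by (intro summable_suminf_not_top) (auto simp: D_def infinity_ennreal_def)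
    then have "summable (\<lambda>k. g (Suc k) t - g k t)"
      unfolding D_def by (rule summable_norm_cancel)
    then have "convergent (\<lambda>n. g n t - g 0 t)"
      by (simp only: summable_iff_convergent sum_lessThan_telescope[of "\<lambda>k. g k t"])
    then have "convergent (\<lambda>n. (g n t - g 0 t) + g 0 t)"
      by (intro convergent_add convergent_const)
    then show ?case by (simp add: convergent_LIMSEQ_iff)
  qed
  \<comment> \<open>\<open>lim\<close> is total, so \<open>F\<close> is measurable as it stands; its
    arbitrary values where the sequence diverges concern a null set.\<close>
  define F where "F t = lim (\<lambda>k. g k t)" for t
  have Fm [measurable]: "F \<in> borel_measurable unit_measure"
    unfolding F_def[abs_def] by measurable
  \<comment> \<open>Each \<open>f m\<close> is compared with the tail of the subsequence. This gives
    convergence of all of \<open>X\<close>, and square integrability of \<open>F\<close> through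
    that of \<open>f m - F\<close>.\<close>
  have fatou: "(\<integral>\<^sup>+ t. ennreal ((norm (f m t - F t))\<^sup>2) \<partial>unit_measure) \<le> ennreal (((1/2) ^ i)\<^sup>2)"
    if m: "m \<ge> M i" for m i
  proof -
    have "(\<integral>\<^sup>+ t. ennreal ((norm (f m t - F t))\<^sup>2) \<partial>unit_measure)
        = (\<integral>\<^sup>+ t. liminf (\<lambda>k. ennreal ((norm (f m t - g k t))\<^sup>2)) \<partial>unit_measure)"
    proof (rule nn_integral_cong_AE)
      show "AE t in unit_measure. ennreal ((norm (f m t - F t))\<^sup>2) = liminf (\<lambda>k. ennreal ((norm (f m t - g k t))\<^sup>2))"
        using lim
      proof eventually_elim
        case (elim t)
        then have "(\<lambda>k. ennreal ((norm (f m t - g k t))\<^sup>2)) \<longlonglongrightarrow> ennreal ((norm (f m t - F t))\<^sup>2)"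
          unfolding F_def by (intro tendsto_intros)
        then show ?case
          by (rule lim_imp_Liminf[OF sequentially_bot, symmetric])
      qed
    qed
    also have "\<dots> \<le> liminf (\<lambda>k. \<integral>\<^sup>+ t. ennreal ((norm (f m t - g k t))\<^sup>2) \<partial>unit_measure)"
      by (rule nn_integral_liminf) measurable
    also have "\<dots> \<le> liminf (\<lambda>k::nat. ennreal (((1/2) ^ i)\<^sup>2))"
    proof (rule Liminf_mono)
      show "\<forall>\<^sub>F k in sequentially. (\<integral>\<^sup>+ t. ennreal ((norm (f m t - g k t))\<^sup>2) \<partial>unit_measure) \<le> ennreal (((1/2) ^ i)\<^sup>2)"
        using eventually_ge_at_top[of i]
      proof eventually_elim
        case (elim k)
        have "norm (X m - X (r k)) \<le> (1/2) ^ i"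
          using M[OF m order_trans[OF r[OF elim] order_refl]] by simp
        then show ?case
          unfolding g_def sq_nn by (intro ennreal_leI power_mono) auto
      qed
    qed
    also have "\<dots> = ennreal (((1/2) ^ i)\<^sup>2)"
      by (rule Liminf_const) simp
    finally show ?thesis .
  qed
  have sq: "square_integrable (\<lambda>t. f m t - F t)" if "m \<ge> M i" for m i
    unfolding square_integrable_def
  proof
    show "integrable unit_measure (\<lambda>t. (norm (f m t - F t))\<^sup>2)"
      using fatou[OF that] by (intro integrableI_bounded) (auto simp: le_less_trans)
  qed measurable
  have F: "square_integrable F"
    using square_integrable_diff[OF f(1) sq[OF order_refl], of "M 0" 0] by simp
  have "X \<longlonglongrightarrow> L2_class F"
    unfolding LIMSEQ_def
  proof (intro allI impI)
    fix e :: real assume "e > 0"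
    then obtain i where i: "(1/2) ^ i < e"
      using real_arch_pow_inv[of e "1/2"] by auto
    have "norm (X m - L2_class F) < e" if m: "m \<ge> M i" for m
    proof -
      have "ennreal ((norm (X m - L2_class F))\<^sup>2) = (\<integral>\<^sup>+ t. ennreal ((norm (f m t - F t))\<^sup>2) \<partial>unit_measure)"
        using sq[OF m] norm_L2_class[OF sq[OF m]] f F
        by (subst nn_integral_eq_integral) (auto simp: square_integrable_def L2_class_diff)
      also note fatou[OF m]
      finally have "(norm (X m - L2_class F))\<^sup>2 \<le> ((1/2) ^ i)\<^sup>2"
        by (subst (asm) ennreal_le_iff) simp_all
      then have "norm (X m - L2_class F) \<le> (1/2) ^ i"
        by (rule power2_le_imp_le) simp
      with i show ?thesis by simp
    qed
    then show "\<exists>no. \<forall>n\<ge>no. dist (X n) (L2_class F) < e"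
      by (auto simp: dist_norm)
  qed
  then show "convergent X"
    by (rule convergentI)
qed

section \<open>Approximation by polynomials in the L2 norm\<close>

lemma square_integrable_bounded:
  assumes "f \<in> borel_measurable unit_measure" "\<And>t. t \<in> {0..1} \<Longrightarrow> norm (f t) \<le> B"
  shows "square_integrable f"
  unfolding square_integrable_def
proof
  show "integrable unit_measure (\<lambda>t. (norm (f t))\<^sup>2)"
  proof (rule Bochner_Integration.integrable_bound[of _ "\<lambda>_. B\<^sup>2"])
    show "(\<lambda>t. (norm (f t))\<^sup>2) \<in> borel_measurable unit_measure"
      using assms(1) by measurable
    show "AE t in unit_measure. norm ((norm (f t))\<^sup>2) \<le> norm (B\<^sup>2)"
      using assms(2) by (intro AE_I2) (simp add: power_mono)
  qed simp
qed (rule assms)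

lemma square_integrable_continuous:
  assumes "continuous_on {0..1} f"
  shows "square_integrable f"
proof -
  have "compact (f ` {0..1})"
    by (rule compact_continuous_image[OF assms]) simp
  then obtain B where "\<And>t. t \<in> {0..1} \<Longrightarrow> norm (f t) \<le> B"
    using compact_imp_bounded bounded_iff by (metis imageI)
  then show ?thesis
    using assms by (intro square_integrable_bounded continuous_imp_measurable_on_sets_lebesgue) auto
qed

text \<open>Three reductions: truncation to bounded functions, approximation of these by continuous
  functions almost everywhere, and uniform Weierstrass approximation, which is stronger than L2
  approximation on an interval of length 1.\<close>

lemma polynomials_dense_L2:
  "closure (L2_class ` {p :: real \<Rightarrow> complex^'n. polynomial_function p}) = UNIV" (is "closure ?P = _")
proof -
  have cont: "L2_class f \<in> closure ?P" if f: "continuous_on {0..1} f" for f :: "real \<Rightarrow> complex^'n"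
    unfolding closure_approachable
  proof (intro allI impI)
    fix e :: real assume e: "e > 0"
    obtain p where p: "polynomial_function p" "\<And>t. t \<in> {0..1} \<Longrightarrow> norm (f t - p t) < e / 2"
      using Stone_Weierstrass_polynomial_function[OF _ f, of "e/2"] e by auto
    have s: "square_integrable f" "square_integrable p"
      using f p(1) by (auto intro: square_integrable_continuous continuous_on_polymonial_function)
    have "norm (L2_class f - L2_class p) \<le> e / 2"
      unfolding L2_class_diff[OF s, symmetric]
      using s p(2) by (intro norm_L2_class_le square_integrable_diff) (auto intro: less_imp_le)
    then show "\<exists>y\<in>?P. dist y (L2_class f) < e"
      using p(1) e by (intro bexI[of _ "L2_class p"]) (auto simp: dist_norm norm_minus_commute)
  qed
  have bdd: "L2_class f \<in> closure ?P"
    if f: "f \<in> borel_measurable unit_measure" "\<And>t. norm (f t) \<le> B" for f :: "real \<Rightarrow> complex^'n" and B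
  proof -
    have B: "0 \<le> B" using order_trans[OF norm_ge_zero f(2)] .
    have "f measurable_on {0..1}"
      using f(1) by (simp add: measurable_on_iff_borel_measurable)
    then obtain N g where N: "negligible N" and g: "\<And>n. continuous_on UNIV (g n)"
      "\<And>t. t \<notin> N \<Longrightarrow> (\<lambda>n. g n t) \<longlonglongrightarrow> (if t \<in> {0..1} then f t else 0)"
      unfolding measurable_on_def by metis
    \<comment> \<open>The continuous approximants \<open>g n\<close> carry no common bound.
      Retracting onto the ball that contains all values of \<open>f\<close> supplies one and leaves
      the limit unchanged.\<close>
    define c where "c = closest_point (cball (0 :: complex^'n) B)"
    have c_cont: "continuous_on UNIV c"
      unfolding c_def using B by (intro continuous_on_closest_point) auto
    have c_le: "norm (c v) \<le> B" for v
      using closest_point_in_set[of "cball (0 :: complex^'n) B" v] B by (auto simp: c_def)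
    have c_id: "c (f t) = f t" for t
      unfolding c_def by (rule closest_point_self) (simp add: f)
    have h_cont: "continuous_on S (\<lambda>t. c (g n t))" for n S
      by (rule continuous_on_subset[OF continuous_on_compose2[OF c_cont g(1)]]) auto
    have sf: "square_integrable f"
      using f by (rule square_integrable_bounded)
    have "(\<lambda>n. L2_class (\<lambda>t. c (g n t))) \<longlonglongrightarrow> L2_class f"
    proof (rule L2_class_dominated_tendsto[where w = "\<lambda>_. (B + B)\<^sup>2"])
      show "(norm (c (g n t) - f t))\<^sup>2 \<le> (B + B)\<^sup>2" for n t
        by (intro power_mono order_trans[OF norm_triangle_ineq4] add_mono c_le f) simp
      have "AE t in lebesgue. t \<notin> N"
        using N by (simp add: AE_not_in negligible_iff_null_sets)
      then have "AE t in unit_measure. t \<notin> N"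
        by (simp add: AE_restrict_space_iff) (auto elim: eventually_mono)
      moreover have "AE t in unit_measure. t \<in> {0..1}"
        by (rule AE_I2) simp
      ultimately show "AE t in unit_measure. (\<lambda>n. c (g n t)) \<longlonglongrightarrow> f t"
      proof eventually_elim
        case (elim t)
        have "isCont c (f t)"
          using c_cont by (simp add: continuous_on_eq_continuous_at)
        with g(2)[OF elim(1)] elim(2) have "(\<lambda>n. c (g n t)) \<longlonglongrightarrow> c (f t)"
          by (auto intro: isCont_tendsto_compose)
        then show ?case by (simp add: c_id)
      qed
    qed (use h_cont sf in \<open>auto intro: square_integrable_continuous\<close>)
    then show ?thesis
      by (rule closed_sequentially[OF closed_closure cont[OF h_cont]])
  qed
  have "x \<in> closure ?P" for x :: "'n L2"
  proof -
    define f where "f = rep_L2 x"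
    have f: "square_integrable f" "L2_class f = x" by (simp_all add: f_def)
    have fm [measurable]: "f \<in> borel_measurable unit_measure"
      using f(1) by (simp add: square_integrable_def)
    \<comment> \<open>The error of the truncation is either 0 or \<open>- f t\<close>, so the square
      of the norm of \<open>f\<close> dominates.\<close>
    define h where "h n t = (if norm (f t) \<le> real n then f t else 0)" for n t
    have h: "h n \<in> borel_measurable unit_measure" "norm (h n t) \<le> real n" for n t
      by (auto simp: h_def[abs_def])
    have "(\<lambda>n. L2_class (h n)) \<longlonglongrightarrow> L2_class f"
    proof (rule L2_class_dominated_tendsto[where w = "\<lambda>t. (norm (f t))\<^sup>2"])
      show "square_integrable (h n)" for n
        using h by (rule square_integrable_bounded)
      show "integrable unit_measure (\<lambda>t. (norm (f t))\<^sup>2)"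
        using f(1) by (simp add: square_integrable_def)
      show "AE t in unit_measure. (\<lambda>n. h n t) \<longlonglongrightarrow> f t"
      proof (rule AE_I2)
        fix t
        obtain k where "norm (f t) \<le> real k"
          using real_arch_simple by blast
        then have "\<forall>\<^sub>F n in sequentially. h n t = f t"
          by (intro eventually_sequentiallyI[of k]) (auto simp: h_def)
        then show "(\<lambda>n. h n t) \<longlonglongrightarrow> f t"
          by (rule tendsto_eventually)
      qed
    qed (use f in \<open>auto simp: h_def\<close>)
    then show ?thesis
      unfolding f(2) by (rule closed_sequentially[OF closed_closure bdd[OF h]])
  qed
  then show ?thesis by blast
qed


section \<open>Primitives and integration by parts\<close>

text \<open>Computed on the chosen representative \<open>rep_L2 x\<close>;
  \<open>total_L2_class\<close> shows that every square integrable representative gives the same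
  value, and \<open>primitive_L2_class\<close> does so for the primitive.\<close>

definition total_L2 :: "'n::finite L2 \<Rightarrow> complex^'n" where
  "total_L2 x = integral {0..1} (rep_L2 x)"

definition primitive_L2 :: "'n::finite L2 \<Rightarrow> 'n L2" where
  "primitive_L2 x = L2_class (\<lambda>t. integral {0..t} (rep_L2 x))"

lemma bounded_linear_vec_scaleC: "bounded_linear (\<lambda>v :: complex^'n. c *s v)"
  by (rule bounded_linear_intro[of _ "cmod c"])
    (simp_all add: vector_add_ldistrib norm_vector_scaleC mult.commute scaleR_vec_eq vector_smult_assoc)

lemma bounded_linear_matrix_vector:
  fixes A :: "complex^'n^'m"
  shows "bounded_linear ((*v) A)"
proof -
  have "linear ((*v) A)"
    by (rule linearI)
      (simp_all add: vec_eq_iff matrix_vector_mult_def scaleR_sum_right distrib_left sum.distrib)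
  then show ?thesis
    by (simp add: linear_conv_bounded_linear)
qed

lemma bounded_bilinear_vec_cinner: "bounded_bilinear (vec_cinner :: complex^'n \<Rightarrow> _)"
proof
  show "\<exists>K. \<forall>v w :: complex^'n. norm (vec_cinner v w) \<le> norm v * norm w * K"
  proof (intro exI allI)
    fix v w :: "complex^'n"
    have "norm (vec_cinner v w) \<le> (\<Sum>i\<in>(UNIV :: 'n set). norm v * norm w)"
      unfolding vec_cinner_def
      by (intro order_trans[OF norm_sum] sum_mono)
        (auto simp: norm_mult intro!: mult_mono Finite_Cartesian_Product.norm_nth_le)
    then show "norm (vec_cinner v w) \<le> norm v * norm w * of_nat CARD('n)"
      by (simp add: mult.commute)
  qed
qed (simp_all add: vec_cinner_def algebra_simps sum.distrib scaleR_sum_right)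

lemma square_integrable_integrable_on:
  assumes "square_integrable f" "0 \<le> t" "t \<le> 1"
  shows "f integrable_on {0..t}"
proof -
  have "f integrable_on {0..1}"
    using integrable_square_integrable[OF assms(1)] by (rule integrable_on_lebesgue_on) simp
  then show ?thesis
    by (rule integrable_on_subinterval) (use assms in auto)
qed

lemma integral_eq_lebesgue_unit:
  fixes f :: "real \<Rightarrow> 'a::euclidean_space"
  assumes "integrable unit_measure f"
  shows "integral {0..1} f = integral\<^sup>L unit_measure f"
  using lebesgue_integral_eq_integral[OF assms] by simp

lemma continuous_on_primitive:
  "square_integrable f \<Longrightarrow> continuous_on {0..1} (\<lambda>t. integral {0..t} f)"
  by (rule indefinite_integral_continuous_1) (simp add: square_integrable_integrable_on)

lemma square_integrable_primitive:
  "square_integrable f \<Longrightarrow> square_integrable (\<lambda>t. integral {0..t} f)"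
  by (rule square_integrable_continuous[OF continuous_on_primitive])

lemma integral_cong_AE_unit:
  fixes f g :: "real \<Rightarrow> 'a::euclidean_space"
  assumes "AE s in unit_measure. f s = g s" "t \<le> 1"
  shows "integral {0..t} f = integral {0..t} g"
proof -
  have "AE s in lebesgue. s \<in> {0..1} \<longrightarrow> f s = g s"
    using assms(1) by (simp add: AE_restrict_space_iff)
  then obtain N where N: "N \<in> null_sets lebesgue" "{s. \<not> (s \<in> {0..1} \<longrightarrow> f s = g s)} \<subseteq> N"
    by (auto simp: eventually_ae_filter)
  show ?thesis
    by (rule integral_spike[of N]) (use N assms(2) in \<open>auto simp: negligible_iff_null_sets\<close>)
qed

lemma total_L2_class: "square_integrable f \<Longrightarrow> total_L2 (L2_class f) = integral {0..1} f"
  unfolding total_L2_def by (rule integral_cong_AE_unit[OF rep_L2_class]) simp_all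

lemma primitive_L2_class:
  assumes "square_integrable f"
  shows "primitive_L2 (L2_class f) = L2_class (\<lambda>t. integral {0..t} f)"
  unfolding primitive_L2_def
  by (rule L2_class_cong(2)[OF integral_cong_AE_unit[OF rep_L2_class[OF assms]]])
    (simp_all add: square_integrable_primitive)

lemma norm_integral_le_L2:
  assumes "square_integrable f" "0 \<le> t" "t \<le> 1"
  shows "norm (integral {0..t} f) \<le> norm (L2_class f)"
proof -
  have i: "integrable unit_measure (\<lambda>s. norm (f s))"
    using integrable_square_integrable[OF assms(1)] by (rule integrable_norm)
  then have "(\<lambda>s. norm (f s)) integrable_on {0..1}"
    by (rule integrable_on_lebesgue_on) simp
  moreover from this have "(\<lambda>s. norm (f s)) integrable_on {0..t}"
    by (rule integrable_on_subinterval) (use assms in auto)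
  ultimately have "norm (integral {0..t} f) \<le> integral {0..1} (\<lambda>s. norm (f s))"
    using assms by (intro order_trans[OF integral_norm_bound_integral integral_subset_le])
      (auto intro: square_integrable_integrable_on)
  also have "\<dots> \<le> norm (L2_class f)"
    using integral_norm_le_L2[OF assms(1)] by (simp add: integral_eq_lebesgue_unit[OF i])
  finally show ?thesis .
qed

lemma L2_class_cases:
  obtains f where "square_integrable f" "x = L2_class f"
  by (metis square_integrable_rep_L2 L2_class_rep_L2)

lemma total_L2_add: "total_L2 (x + y) = total_L2 x + total_L2 y"
proof -
  obtain f where "square_integrable f" "x = L2_class f"
    by (rule L2_class_cases)
  moreover obtain g where "square_integrable g" "y = L2_class g"
    by (rule L2_class_cases)
  ultimately show ?thesis
    by (simp add: L2_class_add[symmetric] total_L2_class square_integrable_add integral_add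
        square_integrable_integrable_on)
qed

lemma integral_vec_scaleC:
  fixes f :: "real \<Rightarrow> complex^'n"
  assumes "f integrable_on S"
  shows "integral S (\<lambda>t. c *s f t) = c *s integral S f"
  using integral_linear[OF assms bounded_linear_vec_scaleC] by (simp add: o_def)

lemma total_L2_scaleC: "total_L2 (c *\<^sub>C x) = c *s total_L2 x"
proof -
  obtain f where "square_integrable f" "x = L2_class f"
    by (rule L2_class_cases)
  then show ?thesis
    by (simp add: L2_class_scaleC[symmetric] total_L2_class square_integrable_scaleC
        integral_vec_scaleC square_integrable_integrable_on)
qed

lemma norm_total_L2_le: "norm (total_L2 x) \<le> norm x"
  by (metis L2_class_cases total_L2_class norm_integral_le_L2 order_refl zero_le_one)

lemma primitive_L2_add: "primitive_L2 (x + y) = primitive_L2 x + primitive_L2 y"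
proof -
  obtain f where f: "square_integrable f" "x = L2_class f"
    by (rule L2_class_cases)
  obtain g where g: "square_integrable g" "y = L2_class g"
    by (rule L2_class_cases)
  have "L2_class (\<lambda>t. integral {0..t} f + integral {0..t} g) = L2_class (\<lambda>t. integral {0..t} (\<lambda>s. f s + g s))"
    using f g by (intro L2_class_cong(2) square_integrable_add square_integrable_primitive)
      (auto simp: integral_add square_integrable_integrable_on)
  then show ?thesis
    using f g by (simp add: L2_class_add[symmetric] primitive_L2_class square_integrable_add
        square_integrable_primitive)
qed

lemma primitive_L2_scaleC: "primitive_L2 (c *\<^sub>C x) = c *\<^sub>C primitive_L2 x"
proof -
  obtain f where f: "square_integrable f" "x = L2_class f"
    by (rule L2_class_cases)
  have "L2_class (\<lambda>t. c *s integral {0..t} f) = L2_class (\<lambda>t. integral {0..t} (\<lambda>s. c *s f s))"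
    using f by (intro L2_class_cong(2) square_integrable_scaleC square_integrable_primitive)
      (auto simp: integral_vec_scaleC square_integrable_integrable_on)
  then show ?thesis
    using f by (simp add: L2_class_scaleC[symmetric] primitive_L2_class square_integrable_scaleC
        square_integrable_primitive)
qed

lemma norm_primitive_L2_le: "norm (primitive_L2 x) \<le> norm x"
proof -
  obtain f where f: "square_integrable f" "x = L2_class f"
    by (rule L2_class_cases)
  then show ?thesis
    by (auto simp: primitive_L2_class intro!: norm_L2_class_le norm_integral_le_L2 square_integrable_primitive)
qed

lemma const_L2_add: "const_L2 (v + w) = const_L2 v + const_L2 w"
  by (simp add: const_L2_def L2_class_add[symmetric])

lemma const_L2_scaleC: "const_L2 (c *s v) = c *\<^sub>C const_L2 v"
  by (simp add: const_L2_def L2_class_scaleC[symmetric])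

lemma norm_const_L2_le: "norm (const_L2 v) \<le> norm v"
  unfolding const_L2_def by (rule norm_L2_class_le) auto

lemma bounded_linear_total_L2: "bounded_linear total_L2"
  by (rule bounded_linear_intro[of _ 1])
    (simp_all add: total_L2_add total_L2_scaleC scaleR_scaleC scaleR_vec_eq norm_total_L2_le)

lemma bounded_linear_primitive_L2: "bounded_linear primitive_L2"
  by (rule bounded_linear_intro[of _ 1])
    (simp_all add: primitive_L2_add primitive_L2_scaleC scaleR_scaleC norm_primitive_L2_le)

lemma bounded_linear_const_L2: "bounded_linear const_L2"
  by (rule bounded_linear_intro[of _ 1])
    (simp_all add: const_L2_add const_L2_scaleC scaleR_scaleC scaleR_vec_eq norm_const_L2_le)

lemma total_const_L2 [simp]: "total_L2 (const_L2 v) = v"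
  by (simp add: const_L2_def total_L2_class)

lemma cinner_const_L2_left: "cinner (const_L2 v) x = vec_cinner v (total_L2 x)"
proof -
  obtain f where f: "square_integrable f" "x = L2_class f"
    by (rule L2_class_cases)
  have i: "integrable unit_measure f"
    by (rule integrable_square_integrable[OF f(1)])
  show ?thesis
    using integral_bounded_linear[OF bounded_bilinear.bounded_linear_right[OF bounded_bilinear_vec_cinner, of v] i]
    by (simp add: f const_L2_def cinner_L2_class total_L2_class integral_eq_lebesgue_unit[OF i])
qed

lemma vec_cinner_commute: "vec_cinner v w = cnj (vec_cinner w v)"
  by (simp add: vec_cinner_def mult.commute)

lemma cinner_const_L2_right: "cinner x (const_L2 v) = vec_cinner (total_L2 x) v"
  by (metis cinner_commute cinner_const_L2_left vec_cinner_commute)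

lemma continuous_on_eq_on_dense:
  fixes f g :: "'a::topological_space \<Rightarrow> 'b::t2_space"
  assumes "continuous_on UNIV f" "continuous_on UNIV g" "closure D = UNIV" "\<And>x. x \<in> D \<Longrightarrow> f x = g x"
  shows "f = g"
proof -
  have "closed {x. f x = g x}"
    using assms(1,2) by (rule closed_Collect_eq)
  then have "closure D \<subseteq> {x. f x = g x}"
    using assms(4) by (intro closure_minimal) auto
  with assms(3) show ?thesis by auto
qed

text \<open>For continuous functions the primitives are differentiable at every point, and the
  fundamental theorem applies to \<open>vec_cinner (F t) (G t)\<close>. The boundary term at 0
  vanishes because both primitives start there.\<close>

lemma cinner_primitive_continuous:
  fixes f g :: "real \<Rightarrow> complex^'n"
  assumes f: "continuous_on {0..1} f" and g: "continuous_on {0..1} g"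
  shows "cinner (primitive_L2 (L2_class f)) (L2_class g) + cinner (L2_class f) (primitive_L2 (L2_class g))
      = vec_cinner (total_L2 (L2_class f)) (total_L2 (L2_class g))"
proof -
  define F where "F t = integral {0..t} f" for t
  define G where "G t = integral {0..t} g" for t
  have sq: "square_integrable f" "square_integrable g" "square_integrable F" "square_integrable G"
    using square_integrable_continuous[OF f] square_integrable_continuous[OF g]
    by (simp_all add: F_def[abs_def] G_def[abs_def] square_integrable_primitive)
  have int: "integrable unit_measure (\<lambda>t. vec_cinner (F t) (g t))" "integrable unit_measure (\<lambda>t. vec_cinner (f t) (G t))"
    using sq by (auto intro: integrable_vec_cinner)
  have "((\<lambda>t. vec_cinner (F t) (g t) + vec_cinner (f t) (G t)) has_integral
      vec_cinner (F 1) (G 1) - vec_cinner (F 0) (G 0)) {0..1}"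
  proof (rule fundamental_theorem_of_calculus)
    fix t :: real assume t: "t \<in> {0..1}"
    have "(F has_vector_derivative f t) (at t within {0..1})" "(G has_vector_derivative g t) (at t within {0..1})"
      unfolding F_def[abs_def] G_def[abs_def]
      by (rule integral_has_vector_derivative[OF f t] integral_has_vector_derivative[OF g t])+
    then show "((\<lambda>t. vec_cinner (F t) (G t)) has_vector_derivative vec_cinner (F t) (g t) + vec_cinner (f t) (G t))
        (at t within {0..1})"
      by (rule bounded_bilinear.has_vector_derivative[OF bounded_bilinear_vec_cinner])
  qed simp
  then have "integral {0..1} (\<lambda>t. vec_cinner (F t) (g t) + vec_cinner (f t) (G t)) = vec_cinner (F 1) (G 1)"
    by (auto simp: F_def G_def integral_unique vec_cinner_def)
  then have "integral\<^sup>L unit_measure (\<lambda>t. vec_cinner (F t) (g t)) + integral\<^sup>L unit_measure (\<lambda>t. vec_cinner (f t) (G t))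
      = vec_cinner (F 1) (G 1)"
    using int by (simp add: integral_eq_lebesgue_unit)
  then show ?thesis
    using sq by (simp add: primitive_L2_class total_L2_class cinner_L2_class F_def[abs_def] G_def[abs_def])
qed

text \<open>Both sides are continuous in each argument separately, so the density of polynomials
  extends the classical case, first in \<open>x\<close> and then in \<open>y\<close>.\<close>

lemma cinner_primitive_L2:
  "cinner (primitive_L2 x) y + cinner x (primitive_L2 y) = vec_cinner (total_L2 x) (total_L2 y)"
proof -
  note cont = bounded_bilinear.continuous_on[OF bounded_bilinear_cinner]
    bounded_bilinear.continuous_on[OF bounded_bilinear_vec_cinner]
    linear_continuous_on[OF bounded_linear_primitive_L2] linear_continuous_on[OF bounded_linear_total_L2]
    continuous_on_const continuous_on_id continuous_on_add
  have 1: "cinner (primitive_L2 x) (L2_class q) + cinner x (primitive_L2 (L2_class q)) = vec_cinner (total_L2 x) (total_L2 (L2_class q))"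
    if q: "polynomial_function q" for q
  proof -
    have "(\<lambda>x. cinner (primitive_L2 x) (L2_class q) + cinner x (primitive_L2 (L2_class q)))
        = (\<lambda>x. vec_cinner (total_L2 x) (total_L2 (L2_class q)))"
      by (rule continuous_on_eq_on_dense[OF _ _ polynomials_dense_L2], (intro cont)+)
        (use q in \<open>auto intro: cinner_primitive_continuous continuous_on_polymonial_function\<close>)
    from fun_cong[OF this, of x] show ?thesis .
  qed
  have "(\<lambda>y. cinner (primitive_L2 x) y + cinner x (primitive_L2 y))
      = (\<lambda>y. vec_cinner (total_L2 x) (total_L2 y))"
    by (rule continuous_on_eq_on_dense[OF _ _ polynomials_dense_L2], (intro cont)+) (use 1 in auto)
  from fun_cong[OF this, of y] show ?thesis .
qed

text \<open>Tested against functions \<open>t (1 - t) p(t)\<close>, which vanish at both end points, integration by parts gives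
  that \<open>t (1 - t) x\<close> is orthogonal to every polynomial \<open>p\<close>.\<close>

lemma primitive_L2_eq_const_imp_zero:
  assumes "primitive_L2 x = const_L2 v"
  shows "x = 0"
proof -
  obtain f where f: "square_integrable f" "x = L2_class f"
    by (rule L2_class_cases)
  define b where "b t = t * (1 - t)" for t :: real
  define k where "k t = b t *\<^sub>R f t" for t
  have fm [measurable]: "f \<in> borel_measurable unit_measure"
    using f(1) by (simp add: square_integrable_def)
  have bm [measurable]: "b \<in> borel_measurable unit_measure"
    unfolding b_def[abs_def] by (intro continuous_imp_measurable_on_sets_lebesgue continuous_intros) simp
  have b_le: "\<bar>b t\<bar> \<le> 1" if "t \<in> {0..1}" for t
    using that mult_mono[of t 1 "1 - t" 1] by (auto simp: b_def abs_mult)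
  have k: "square_integrable k"
    unfolding square_integrable_def
  proof
    show "integrable unit_measure (\<lambda>t. (norm (k t))\<^sup>2)"
    proof (rule Bochner_Integration.integrable_bound)
      show "integrable unit_measure (\<lambda>t. (norm (f t))\<^sup>2)"
        using f(1) by (simp add: square_integrable_def)
      have "norm (k t) \<le> norm (f t)" if "t \<in> {0..1}" for t
        using mult_right_mono[OF b_le[OF that], of "norm (f t)"] by (simp add: k_def)
      then show "AE t in unit_measure. norm ((norm (k t))\<^sup>2) \<le> norm ((norm (f t))\<^sup>2)"
        by (intro AE_I2) (simp add: power_mono)
    qed (simp add: k_def)
  qed (simp add: k_def[abs_def])
  have orth: "cinner (L2_class k) (L2_class p) = 0" if p: "polynomial_function p" for p
  proof -
    define \<psi> where "\<psi> t = b t *\<^sub>R p t" for t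
    have "polynomial_function (\<lambda>t :: real. t *\<^sub>R (1 - t))"
      by (intro polynomial_function_mult polynomial_function_diff) auto
    then have "polynomial_function \<psi>"
      unfolding \<psi>_def[abs_def] b_def[abs_def] using p
      by (intro polynomial_function_mult) auto
    then obtain q where q: "polynomial_function q" "\<And>t. (\<psi> has_vector_derivative q t) (at t)"
      using has_vector_derivative_polynomial_function by blast
    have int: "integral {0..t} q = \<psi> t" if "0 \<le> t" for t
    proof -
      have "(q has_integral \<psi> t - \<psi> 0) {0..t}"
        using q(2) that by (intro fundamental_theorem_of_calculus)
          (auto intro: has_vector_derivative_at_within)
      then show ?thesis
        by (simp add: integral_unique \<psi>_def b_def)
    qed
    have sq: "square_integrable p" "square_integrable q" "square_integrable \<psi>"
      using p q(1) \<open>polynomial_function \<psi>\<close>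
      by (auto intro: square_integrable_continuous continuous_on_polymonial_function)
    have tot: "total_L2 (L2_class q) = 0"
      by (simp add: total_L2_class sq int \<psi>_def b_def)
    have prim: "primitive_L2 (L2_class q) = L2_class \<psi>"
      unfolding primitive_L2_class[OF sq(2)]
      by (rule sym, rule L2_class_cong(2)) (auto simp: int sq)
    \<comment> \<open>In the integration by parts for \<open>x\<close> and \<open>q\<close>, both
      the constant \<open>v\<close> and the total of \<open>x\<close> are paired with the total of
      \<open>q\<close>, which is 0.\<close>
    have "cinner x (L2_class \<psi>) = 0"
      using cinner_primitive_L2[of x "L2_class q"]
      by (simp add: assms cinner_const_L2_left tot prim vec_cinner_def)
    moreover have "vec_cinner (f t) (\<psi> t) = vec_cinner (k t) (p t)" for t
      by (simp add: vec_cinner_def \<psi>_def k_def)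
    ultimately show ?thesis
      using sq k f by (simp add: cinner_L2_class)
  qed
  have "cinner (L2_class k) = (\<lambda>_. 0)"
  proof (rule continuous_on_eq_on_dense[OF _ continuous_on_const polynomials_dense_L2])
    show "continuous_on UNIV (cinner (L2_class k))"
      by (intro linear_continuous_on bounded_bilinear.bounded_linear_right[OF bounded_bilinear_cinner])
  qed (use orth in auto)
  then have "inner (L2_class k) (L2_class k) = 0"
    by (simp add: inner_eq_Re_cinner)
  then have "L2_class k = L2_class (\<lambda>_. 0)"
    by (metis inner_eq_zero_iff zero_L2_def L2_class_def)
  then have "AE t in unit_measure. k t = 0"
    using k by (simp add: L2_class_eq_iff)
  \<comment> \<open>The weight \<open>b\<close> vanishes on the interval at its end points only, so
    off this null set \<open>k t = 0\<close> forces \<open>f t = 0\<close>.\<close>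
  moreover have "AE t in lebesgue. t \<notin> {0, 1}"
    by (rule AE_not_in) (simp add: negligible_iff_null_sets[symmetric])
  then have "AE t in unit_measure. t \<notin> {0, 1}"
    by (simp add: AE_restrict_space_iff) (auto elim: eventually_mono)
  ultimately have "AE t in unit_measure. f t = 0"
    by eventually_elim (auto simp: k_def b_def)
  then have "L2_class f = L2_class (\<lambda>_. 0)"
    using f by (simp add: L2_class_eq_iff)
  then show ?thesis
    by (simp add: f zero_L2_def L2_class_def)
qed


section \<open>The graphs of the universal family\<close>

lemma deriv01_eqI:
  assumes "t \<in> {0..1}" "(f has_vector_derivative d) (at t within {0..1})"
  shows "deriv01 f t = d"
  unfolding deriv01_def by (rule vector_derivative_within_closed_interval[OF _ assms]) simp

lemma smooth01_has_vector_derivative: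
  assumes "smooth01 f" "t \<in> {0..1}"
  shows "(f has_vector_derivative deriv01 f t) (at t within {0..1})"
proof -
  have "((deriv01 ^^ 0) f) differentiable (at t within {0..1})"
    using assms unfolding smooth01_def by blast
  then show ?thesis
    unfolding deriv01_def by (simp add: vector_derivative_works)
qed

lemma smooth01_continuous:
  assumes "smooth01 f"
  shows "continuous_on {0..1} f" "continuous_on {0..1} (deriv01 f)"
proof -
  have "continuous_on {0..1} ((deriv01 ^^ k) f)" for k
    using assms by (simp add: smooth01_def continuous_on_eq_continuous_within
        differentiable_imp_continuous_within)
  from this[of 0] this[of 1] show "continuous_on {0..1} f" "continuous_on {0..1} (deriv01 f)"
    by simp_all
qed

lemma smooth01_square_integrable:
  assumes "smooth01 f"
  shows "square_integrable f" "square_integrable (deriv01 f)"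
  using smooth01_continuous[OF assms] by (auto intro: square_integrable_continuous)

lemma smooth01_integral_deriv01:
  assumes "smooth01 f" "0 \<le> t" "t \<le> 1"
  shows "integral {0..t} (deriv01 f) = f t - f 0"
proof (rule integral_unique, rule fundamental_theorem_of_calculus)
  fix s assume "s \<in> {0..t}"
  with assms show "(f has_vector_derivative deriv01 f s) (at s within {0..t})"
    by (intro has_vector_derivative_within_subset[OF smooth01_has_vector_derivative]) auto
qed (use assms in simp)

lemma smooth01_total_L2:
  "smooth01 f \<Longrightarrow> total_L2 (L2_class (deriv01 f)) = f 1 - f 0"
  by (simp add: total_L2_class smooth01_square_integrable smooth01_integral_deriv01)

lemma smooth01_L2_class:
  assumes "smooth01 f"
  shows "L2_class f = const_L2 (f 0) + primitive_L2 (L2_class (deriv01 f))"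
proof -
  have sq: "square_integrable (\<lambda>t. integral {0..t} (deriv01 f))"
    using assms by (intro square_integrable_primitive smooth01_square_integrable)
  have "L2_class (\<lambda>t. f 0 + integral {0..t} (deriv01 f)) = L2_class f"
    using assms sq by (intro L2_class_cong(2) square_integrable_add)
      (auto simp: smooth01_integral_deriv01)
  then show ?thesis
    using assms sq
    by (simp add: const_L2_def primitive_L2_class smooth01_square_integrable L2_class_add)
qed

text \<open>The Sobolev norm is the graph norm of the derivative: Sobolev-Cauchy means that both the
  classes and the classes of the derivatives are Cauchy in L2.\<close>

lemma sobolev_norm_diff:
  assumes f: "smooth01 f" and g: "smooth01 g"
  shows "sobolev_norm (\<lambda>t. f t - g t) =
    sqrt ((norm (L2_class (deriv01 f) - L2_class (deriv01 g)))\<^sup>2 + (norm (L2_class f - L2_class g))\<^sup>2)"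
proof -
  define d where "d t = deriv01 f t - deriv01 g t" for t
  have sq: "square_integrable d" "square_integrable (\<lambda>t. f t - g t)"
    using smooth01_square_integrable[OF f] smooth01_square_integrable[OF g]
    by (auto simp: d_def[abs_def] intro: square_integrable_diff)
  have d: "deriv01 (\<lambda>t. f t - g t) t = d t" if "t \<in> {0..1}" for t
    unfolding d_def by (rule deriv01_eqI[OF that])
      (intro has_vector_derivative_diff smooth01_has_vector_derivative f g that)
  have int: "integrable unit_measure (\<lambda>t. (norm (d t))\<^sup>2)" "integrable unit_measure (\<lambda>t. (norm (f t - g t))\<^sup>2)"
    using sq by (simp_all add: square_integrable_def)
  have "integral {0..1} (\<lambda>t. (norm (deriv01 (\<lambda>t. f t - g t) t))\<^sup>2 + (norm (f t - g t))\<^sup>2)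
      = integral {0..1} (\<lambda>t. (norm (d t))\<^sup>2 + (norm (f t - g t))\<^sup>2)"
    by (rule Henstock_Kurzweil_Integration.integral_cong) (simp add: d)
  also have "\<dots> = (norm (L2_class d))\<^sup>2 + (norm (L2_class (\<lambda>t. f t - g t)))\<^sup>2"
    using int by (simp add: integral_eq_lebesgue_unit norm_L2_class[OF sq(1)] norm_L2_class[OF sq(2)])
  finally show ?thesis
    using smooth01_square_integrable[OF f] smooth01_square_integrable[OF g]
    by (simp add: sobolev_norm_def d_def[abs_def] L2_class_diff)
qed

text \<open>For negative \<open>t\<close> the interval \<open>{0..t}\<close> is empty and
  \<open>\<phi>\<close> is constant, so \<open>\<phi>\<close> need not be a polynomial on the whole
  line. The induction therefore only claims that its iterated derivatives agree with polynomials on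
  the unit interval.\<close>

lemma smooth01_primitive_polynomial:
  fixes p :: "real \<Rightarrow> complex^'n" and v :: "complex^'n"
  assumes p: "polynomial_function p"
  defines "\<phi> \<equiv> \<lambda>t. v + integral {0..t} p"
  shows "smooth01 \<phi>" "t \<in> {0..1} \<Longrightarrow> deriv01 \<phi> t = p t"
proof -
  have deriv: "(\<phi> has_vector_derivative p t) (at t within {0..1})" if "t \<in> {0..1}" for t
    using has_vector_derivative_add[OF has_vector_derivative_const
        integral_has_vector_derivative[OF continuous_on_polymonial_function[OF p] that], of v]
    by (simp add: \<phi>_def)
  then show "deriv01 \<phi> t = p t" if "t \<in> {0..1}" for t
    using that by (intro deriv01_eqI)
  have step: "(h has_vector_derivative q' t) (at t within {0..1})"
    if "\<And>t. t \<in> {0..1} \<Longrightarrow> h t = q t" "\<And>t. (q has_vector_derivative q' t) (at t)" "t \<in> {0..1}"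
    for h q q' :: "real \<Rightarrow> complex^'n" and t
    using that(3,1) has_vector_derivative_at_within[OF that(2)] by (rule has_vector_derivative_transform)
  have iter: "\<exists>q. polynomial_function q \<and> (\<forall>t\<in>{0..1}. (deriv01 ^^ Suc k) \<phi> t = q t)" for k
  proof (induction k)
    case 0
    show ?case
      using p deriv by (intro exI[of _ p]) (auto intro: deriv01_eqI)
  next
    case (Suc k)
    then obtain q where q: "polynomial_function q" "\<And>t. t \<in> {0..1} \<Longrightarrow> (deriv01 ^^ Suc k) \<phi> t = q t"
      by blast
    obtain q' where q': "polynomial_function q'" "\<And>t. (q has_vector_derivative q' t) (at t)"
      using has_vector_derivative_polynomial_function[OF q(1)] by blast
    have "deriv01 ((deriv01 ^^ Suc k) \<phi>) t = q' t" if "t \<in> {0..1}" for t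
      by (rule deriv01_eqI[OF that step[OF q(2) q'(2) that]])
    with q'(1) show ?case by auto
  qed
  have "(deriv01 ^^ k) \<phi> differentiable (at t within {0..1})" if t: "t \<in> {0..1}" for k t
  proof (cases k)
    case 0
    then show ?thesis
      using deriv[OF t] by (auto intro: differentiableI_vector)
  next
    case (Suc j)
    obtain q where q: "polynomial_function q" "\<And>t. t \<in> {0..1} \<Longrightarrow> (deriv01 ^^ Suc j) \<phi> t = q t"
      using iter[of j] by blast
    obtain q' where q': "\<And>t. (q has_vector_derivative q' t) (at t)"
      using has_vector_derivative_polynomial_function[OF q(1)] by blast
    show ?thesis
      unfolding Suc using step[OF q(2) q' t] by (rule differentiableI_vector)
  qed
  then show "smooth01 \<phi>"
    by (simp add: smooth01_def)
qed

text \<open>The boundary condition survives the limit because the initial values converge: they are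
  what remains of \<open>\<phi> k\<close> after subtracting the primitive of its derivative, and
  \<open>total_L2\<close> reads them off continuously. In terms of derivative and initial value the
  boundary condition fixes the total of the derivative.\<close>

lemma sobolev_approx_limit:
  assumes "sobolev_approx U \<phi> f"
  obtains h v where "(\<lambda>k. L2_class (deriv01 (\<phi> k))) \<longlonglongrightarrow> h"
    "f = const_L2 v + primitive_L2 h" "total_L2 h = U *v v - v"
proof -
  have smooth: "smooth01 (\<phi> k)" and bc: "\<phi> k 1 = U *v \<phi> k 0" for k
    using assms by (auto simp: sobolev_approx_def smooth_bc_def)
  have f: "(\<lambda>k. L2_class (\<phi> k)) \<longlonglongrightarrow> f"
    using assms by (simp add: sobolev_approx_def)
  define h where "h k = L2_class (deriv01 (\<phi> k))" for k
  have "Cauchy h"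
  proof (rule metric_CauchyI)
    fix e :: real assume "e > 0"
    then obtain M where M: "\<And>m n. m \<ge> M \<Longrightarrow> n \<ge> M \<Longrightarrow> sobolev_norm (\<lambda>t. \<phi> m t - \<phi> n t) < e"
      using assms unfolding sobolev_approx_def by blast
    have "dist (h m) (h n) < e" if "m \<ge> M" "n \<ge> M" for m n
    proof -
      have "norm (h m - h n) \<le> sobolev_norm (\<lambda>t. \<phi> m t - \<phi> n t)"
        unfolding sobolev_norm_diff[OF smooth smooth] h_def by (rule real_le_rsqrt) simp
      with M[OF that] show ?thesis by (simp add: dist_norm)
    qed
    then show "\<exists>M. \<forall>m\<ge>M. \<forall>n\<ge>M. dist (h m) (h n) < e" by blast
  qed
  then obtain h' where h': "h \<longlonglongrightarrow> h'"
    using Cauchy_convergent convergent_def by blast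
  have prim: "(\<lambda>k. primitive_L2 (h k)) \<longlonglongrightarrow> primitive_L2 h'"
    by (rule bounded_linear.tendsto[OF bounded_linear_primitive_L2 h'])
  have "(\<lambda>k. L2_class (\<phi> k) - primitive_L2 (h k)) \<longlonglongrightarrow> f - primitive_L2 h'"
    by (rule tendsto_diff[OF f prim])
  moreover have "L2_class (\<phi> k) - primitive_L2 (h k) = const_L2 (\<phi> k 0)" for k
    by (simp add: smooth01_L2_class[OF smooth] h_def)
  ultimately have const: "(\<lambda>k. const_L2 (\<phi> k 0)) \<longlonglongrightarrow> f - primitive_L2 h'"
    by simp
  define v where "v = total_L2 (f - primitive_L2 h')"
  have v: "(\<lambda>k. \<phi> k 0) \<longlonglongrightarrow> v"
    using bounded_linear.tendsto[OF bounded_linear_total_L2 const] by (simp add: v_def)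
  have "f - primitive_L2 h' = const_L2 v"
    by (rule LIMSEQ_unique[OF const bounded_linear.tendsto[OF bounded_linear_const_L2 v]])
  moreover have "total_L2 h' = U *v v - v"
  proof (rule LIMSEQ_unique)
    show "(\<lambda>k. total_L2 (h k)) \<longlonglongrightarrow> total_L2 h'"
      by (rule bounded_linear.tendsto[OF bounded_linear_total_L2 h'])
    have "(\<lambda>k. U *v \<phi> k 0 - \<phi> k 0) \<longlonglongrightarrow> U *v v - v"
      by (intro tendsto_diff bounded_linear.tendsto[OF bounded_linear_matrix_vector] v)
    then show "(\<lambda>k. total_L2 (h k)) \<longlonglongrightarrow> U *v v - v"
      by (simp add: h_def smooth01_total_L2[OF smooth] bc)
  qed
  ultimately show thesis
    using h' by (intro that[of h' v]) (simp_all add: h_def[abs_def] diff_eq_eq)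
qed

text \<open>Approximate the derivative by polynomials and integrate from the fixed initial value
  \<open>v\<close>. The boundary condition must hold exactly for every \<open>k\<close>, so each
  polynomial is first corrected by a constant.\<close>

lemma sobolev_approx_exists:
  assumes "total_L2 h = U *v v - v"
  obtains \<phi> where "sobolev_approx U \<phi> (const_L2 v + primitive_L2 h)"
    "(\<lambda>k. L2_class (deriv01 (\<phi> k))) \<longlonglongrightarrow> h"
proof -
  have "h \<in> closure (L2_class ` {p. polynomial_function p})"
    using polynomials_dense_L2 by blast
  then obtain y where y: "\<And>k. y k \<in> L2_class ` {p. polynomial_function p}" "y \<longlonglongrightarrow> h"
    by (auto simp: closure_sequential)
  have "\<forall>k. \<exists>p. polynomial_function p \<and> y k = L2_class p"
    using y(1) by blast
  then obtain p where p: "\<And>k. polynomial_function (p k)" "\<And>k. y k = L2_class (p k)"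
    by metis
  \<comment> \<open>Adding \<open>a k\<close> restores the total of \<open>h\<close>, and
    \<open>a k\<close> tends to 0 because \<open>total_L2\<close> is bounded.\<close>
  define a where "a k = total_L2 h - total_L2 (y k)" for k
  define q where "q k t = p k t + a k" for k t
  define \<phi> where "\<phi> k t = v + integral {0..t} (q k)" for k t
  have q: "polynomial_function (q k)" for k
    unfolding q_def[abs_def] using p(1) by auto
  have smooth: "smooth01 (\<phi> k)" and deriv: "t \<in> {0..1} \<Longrightarrow> deriv01 (\<phi> k) t = q k t" for k t
    unfolding \<phi>_def[abs_def] using smooth01_primitive_polynomial[OF q] by auto
  have sq: "square_integrable (p k)" "square_integrable (q k)" for k
    using p(1) q by (auto intro: square_integrable_continuous continuous_on_polymonial_function)
  have deriv_class: "L2_class (deriv01 (\<phi> k)) = y k + const_L2 (a k)" for k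
  proof -
    have "L2_class (deriv01 (\<phi> k)) = L2_class (q k)"
      using sq by (intro L2_class_cong(2)[symmetric]) (simp_all add: deriv)
    then show ?thesis
      using sq by (simp add: q_def[abs_def] L2_class_add p const_L2_def)
  qed
  have "a \<longlonglongrightarrow> total_L2 h - total_L2 h"
    unfolding a_def[abs_def]
    by (intro tendsto_intros bounded_linear.tendsto[OF bounded_linear_total_L2] y)
  then have "(\<lambda>k. y k + const_L2 (a k)) \<longlonglongrightarrow> h + const_L2 (total_L2 h - total_L2 h)"
    by (intro tendsto_add y(2) bounded_linear.tendsto[OF bounded_linear_const_L2])
  moreover have "const_L2 (0 :: complex^'a) = 0"
    using const_L2_scaleC[of 0 0] by simp
  ultimately have lim: "(\<lambda>k. L2_class (deriv01 (\<phi> k))) \<longlonglongrightarrow> h"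
    by (simp add: deriv_class)
  have \<phi>0: "\<phi> k 0 = v" for k
    by (simp add: \<phi>_def)
  have "\<phi> k 1 - \<phi> k 0 = total_L2 h" for k
    using smooth01_total_L2[OF smooth, of k]
    by (simp add: deriv_class total_L2_add a_def)
  then have bc: "\<phi> k 1 = U *v \<phi> k 0" for k
    using assms by (simp add: \<phi>0 algebra_simps)
  have "L2_class (\<phi> k) = const_L2 v + primitive_L2 (L2_class (deriv01 (\<phi> k)))" for k
    using smooth01_L2_class[OF smooth] by (simp add: \<phi>0)
  then have lim': "(\<lambda>k. L2_class (\<phi> k)) \<longlonglongrightarrow> const_L2 v + primitive_L2 h"
    using tendsto_add[OF tendsto_const bounded_linear.tendsto[OF bounded_linear_primitive_L2 lim]]
    by simp
  have "\<exists>M. \<forall>m\<ge>M. \<forall>n\<ge>M. sobolev_norm (\<lambda>t. \<phi> m t - \<phi> n t) < e" if e: "e > 0" for e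
  proof -
    have "Cauchy (\<lambda>k. L2_class (deriv01 (\<phi> k)))" "Cauchy (\<lambda>k. L2_class (\<phi> k))"
      using lim lim' by (auto intro: LIMSEQ_imp_Cauchy)
    then obtain M1 M2 where
      M1: "\<And>m n. m \<ge> M1 \<Longrightarrow> n \<ge> M1 \<Longrightarrow> norm (L2_class (deriv01 (\<phi> m)) - L2_class (deriv01 (\<phi> n))) < e / 2" and
      M2: "\<And>m n. m \<ge> M2 \<Longrightarrow> n \<ge> M2 \<Longrightarrow> norm (L2_class (\<phi> m) - L2_class (\<phi> n)) < e / 2"
      using e unfolding Cauchy_def dist_norm by (meson half_gt_zero)
    have "sobolev_norm (\<lambda>t. \<phi> m t - \<phi> n t) < e" if "m \<ge> max M1 M2" "n \<ge> max M1 M2" for m n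
    proof -
      have "sobolev_norm (\<lambda>t. \<phi> m t - \<phi> n t) \<le>
          norm (L2_class (deriv01 (\<phi> m)) - L2_class (deriv01 (\<phi> n))) + norm (L2_class (\<phi> m) - L2_class (\<phi> n))"
        unfolding sobolev_norm_diff[OF smooth smooth] by (rule sqrt_sum_squares_le_sum) auto
      with M1[of m n] M2[of m n] that show ?thesis by auto
    qed
    then show ?thesis by blast
  qed
  then have "sobolev_approx U \<phi> (const_L2 v + primitive_L2 h)"
    using smooth bc lim' by (simp add: sobolev_approx_def smooth_bc_def)
  with lim show thesis by (rule that[rotated])
qed

text \<open>The description in \<open>op_T\<close> is single valued: two representing sequences of
  the same element have limiting derivatives whose difference has a constant primitive, and
  \<open>primitive_L2_eq_const_imp_zero\<close> makes that difference 0.\<close>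

lemma op_T_eq:
  assumes "total_L2 h = U *v v - v"
  shows "const_L2 v + primitive_L2 h \<in> dom_T U" "op_T U (const_L2 v + primitive_L2 h) = - \<i> *\<^sub>C h"
proof -
  obtain \<phi> where \<phi>: "sobolev_approx U \<phi> (const_L2 v + primitive_L2 h)"
    "(\<lambda>k. L2_class (deriv01 (\<phi> k))) \<longlonglongrightarrow> h"
    using assms by (rule sobolev_approx_exists)
  then show "const_L2 v + primitive_L2 h \<in> dom_T U"
    by (auto simp: dom_T_def)
  have lim: "(\<lambda>k. L2_class (\<lambda>t. - \<i> *s deriv01 (\<psi> k) t)) \<longlonglongrightarrow> - \<i> *\<^sub>C h'"
    if "sobolev_approx U \<psi> f" "(\<lambda>k. L2_class (deriv01 (\<psi> k))) \<longlonglongrightarrow> h'" for \<psi> f h'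
  proof -
    have "smooth01 (\<psi> k)" for k
      using that by (simp add: sobolev_approx_def smooth_bc_def)
    then have "L2_class (\<lambda>t. - \<i> *s deriv01 (\<psi> k) t) = - \<i> *\<^sub>C L2_class (deriv01 (\<psi> k))" for k
      by (simp only: L2_class_scaleC smooth01_square_integrable)
    then show ?thesis
      using bounded_linear.tendsto[OF bounded_linear_scaleC[of "- \<i>"] that(2)] by simp
  qed
  show "op_T U (const_L2 v + primitive_L2 h) = - \<i> *\<^sub>C h"
    unfolding op_T_def
  proof (rule the_equality)
    show "\<exists>\<phi>. sobolev_approx U \<phi> (const_L2 v + primitive_L2 h) \<and>
        (\<lambda>k. L2_class (\<lambda>t. - \<i> *s deriv01 (\<phi> k) t)) \<longlonglongrightarrow> - \<i> *\<^sub>C h"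
      using \<phi>(1) lim[OF \<phi>] by blast
  next
    fix g
    assume "\<exists>\<psi>. sobolev_approx U \<psi> (const_L2 v + primitive_L2 h) \<and>
        (\<lambda>k. L2_class (\<lambda>t. - \<i> *s deriv01 (\<psi> k) t)) \<longlonglongrightarrow> g"
    then obtain \<psi> where \<psi>: "sobolev_approx U \<psi> (const_L2 v + primitive_L2 h)"
      "(\<lambda>k. L2_class (\<lambda>t. - \<i> *s deriv01 (\<psi> k) t)) \<longlonglongrightarrow> g" by blast
    obtain h' v' where h': "(\<lambda>k. L2_class (deriv01 (\<psi> k))) \<longlonglongrightarrow> h'"
      "const_L2 v + primitive_L2 h = const_L2 v' + primitive_L2 h'"
      by (rule sobolev_approx_limit[OF \<psi>(1)])
    have "primitive_L2 (h - h') = primitive_L2 h - primitive_L2 h'" "const_L2 (v' - v) = const_L2 v' - const_L2 v"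
      by (intro linear_diff bounded_linear.linear bounded_linear_primitive_L2 bounded_linear_const_L2)+
    with h'(2) have "primitive_L2 (h - h') = const_L2 (v' - v)"
      by (metis add_diff_cancel_left' add_diff_eq diff_add_eq diff_eq_eq)
    then have "h = h'"
      using primitive_L2_eq_const_imp_zero by fastforce
    with LIMSEQ_unique[OF \<psi>(2) lim[OF \<psi>(1) h'(1)]] show "g = - \<i> *\<^sub>C h" by simp
  qed
qed

lemma universal_family_eq:
  "universal_family U = {(- \<i> *\<^sub>C h, const_L2 v + primitive_L2 h) | h v. total_L2 h = U *v v - v}"
proof (intro set_eqI iffI)
  fix p assume "p \<in> universal_family U"
  then obtain f \<phi> where f: "p = (op_T U f, f)" "sobolev_approx U \<phi> f"
    by (auto simp: universal_family_def dom_T_def)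
  obtain h v where "f = const_L2 v + primitive_L2 h" "total_L2 h = U *v v - v"
    by (rule sobolev_approx_limit[OF f(2)])
  with f(1) show "p \<in> {(- \<i> *\<^sub>C h, const_L2 v + primitive_L2 h) | h v. total_L2 h = U *v v - v}"
    by (auto simp: op_T_eq)
qed (auto simp: universal_family_def op_T_eq intro!: exI)


section \<open>The interpolating family of lagrangians\<close>

text \<open>A \<open>blinfun\<close> is only real linear, hence the first clause. Bounded operators
  are used so that \<open>lag_param\<close> can be composed, and its continuity read off, in the
  operator norm.\<close>

definition unitary_op :: "((complex^'n) \<Rightarrow>\<^sub>L (complex^'n)) \<Rightarrow> bool" where
  "unitary_op Q \<longleftrightarrow> (\<forall>c v. blinfun_apply Q (c *s v) = c *s blinfun_apply Q v) \<and>
     (\<forall>v w. vec_cinner (blinfun_apply Q v) (blinfun_apply Q w) = vec_cinner v w) \<and> surj (blinfun_apply Q)"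

text \<open>The graph of the operator with boundary condition \<open>f 1 = U (f 0)\<close> is parametrized by \<open>(f 0, f')\<close>. For
  real \<open>b\<close>, \<open>c\<close> the vectors \<open>(b Q - c) n\<close> and \<open>(c Q - b) n\<close> have the same norm, and their difference is
  \<open>(c - b) (1 + Q) n\<close>; the choice \<open>c = 1\<close>, \<open>b = 1 - r\<close> makes the boundary values of
  \<open>const_L2 ((b Q - c) n) + r primitive_L2 h\<close> unitarily related, also in the limit \<open>r = 0\<close>.\<close>

definition lag_second ::
  "real \<Rightarrow> ((complex^'n) \<Rightarrow>\<^sub>L (complex^'n)) \<Rightarrow> 'n::finite L2 \<Rightarrow> complex^'n \<Rightarrow> 'n L2" where
  "lag_second r Q h n = \<i> *\<^sub>C (const_L2 ((1 - r) *\<^sub>R blinfun_apply Q n - n) + r *\<^sub>R primitive_L2 h)"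

definition lag_family :: "real \<Rightarrow> ((complex^'n) \<Rightarrow>\<^sub>L (complex^'n)) \<Rightarrow> 'n::finite Hhat set" where
  "lag_family r Q = {(h, lag_second r Q h n) | h n. total_L2 h = n + blinfun_apply Q n}"

lemmas total_L2_linear = bounded_linear.linear[OF bounded_linear_total_L2]
lemmas const_L2_linear = bounded_linear.linear[OF bounded_linear_const_L2]
lemmas primitive_L2_linear = bounded_linear.linear[OF bounded_linear_primitive_L2]

lemmas L2_linear_simps =
  linear_0[OF total_L2_linear] linear_diff[OF total_L2_linear] linear_neg[OF total_L2_linear]
  linear_scale[OF total_L2_linear] total_L2_add
  linear_0[OF const_L2_linear] linear_diff[OF const_L2_linear] linear_neg[OF const_L2_linear]
  linear_scale[OF const_L2_linear] const_L2_add
  linear_0[OF primitive_L2_linear] linear_diff[OF primitive_L2_linear] linear_neg[OF primitive_L2_linear]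
  linear_scale[OF primitive_L2_linear] primitive_L2_add

lemmas vec_cinner_simps =
  bounded_bilinear.add_left[OF bounded_bilinear_vec_cinner]
  bounded_bilinear.add_right[OF bounded_bilinear_vec_cinner]
  bounded_bilinear.diff_left[OF bounded_bilinear_vec_cinner]
  bounded_bilinear.diff_right[OF bounded_bilinear_vec_cinner]
  bounded_bilinear.minus_left[OF bounded_bilinear_vec_cinner]
  bounded_bilinear.minus_right[OF bounded_bilinear_vec_cinner]
  bounded_bilinear.scaleR_left[OF bounded_bilinear_vec_cinner]
  bounded_bilinear.scaleR_right[OF bounded_bilinear_vec_cinner]
  bounded_bilinear.zero_left[OF bounded_bilinear_vec_cinner]
  bounded_bilinear.zero_right[OF bounded_bilinear_vec_cinner]

lemma vec_cinner_scaleC_left: "vec_cinner (c *s v) w = c * vec_cinner v w"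
  by (simp add: vec_cinner_def sum_distrib_left mult.assoc)

lemma vec_cinner_scaleC_right: "vec_cinner v (c *s w) = cnj c * vec_cinner v w"
  by (simp add: vec_cinner_def sum_distrib_left mult_ac)

lemma vec_cinner_eqI:
  assumes "\<And>w. vec_cinner u w = vec_cinner v w"
  shows "u = v"
proof -
  have "inner (u - v) (u - v) = 0"
    using assms by (simp add: inner_vec_eq_Re vec_cinner_simps)
  then show ?thesis by simp
qed

lemma unitary_op_norm:
  assumes "unitary_op Q"
  shows "norm (blinfun_apply Q v) = norm v"
  using assms by (simp add: unitary_op_def norm_eq_sqrt_inner inner_vec_eq_Re)

lemma csubspace_lag_family:
  assumes "unitary_op Q"
  shows "csubspace (lag_family r Q)"
proof (rule complex_vector.subspaceI)
  have add: "lag_second r Q h n + lag_second r Q h' n' = lag_second r Q (h + h') (n + n')" for h h' n n'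
    unfolding lag_second_def scaleC_add_right[symmetric]
    by (rule arg_cong[of _ _ "\<lambda>x. \<i> *\<^sub>C x"]) (simp add: L2_linear_simps blinfun.add_right algebra_simps)
  have scale: "c *\<^sub>C lag_second r Q h n = lag_second r Q (c *\<^sub>C h) (c *s n)" for c h n
  proof -
    have "(1 - r) *\<^sub>R blinfun_apply Q (c *s n) - c *s n = c *s ((1 - r) *\<^sub>R blinfun_apply Q n - n)"
      using assms by (simp add: unitary_op_def vec_eq_iff scaleR_conv_of_real algebra_simps)
    then show ?thesis
      by (simp only: lag_second_def primitive_L2_scaleC const_L2_scaleC scaleC_add_right scaleC_scaleC
          scaleC_scaleR mult.commute[of c \<i>])
  qed
  have "lag_second r Q 0 0 = 0"
    by (simp add: lag_second_def L2_linear_simps blinfun.zero_right)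
  then show "0 \<in> lag_family r Q"
    unfolding lag_family_def zero_prod_def
    by (auto simp: L2_linear_simps blinfun.zero_right intro!: exI[of _ 0])
  show "x + y \<in> lag_family r Q" if "x \<in> lag_family r Q" "y \<in> lag_family r Q" for x y
    using that unfolding lag_family_def
    by (fastforce simp: add total_L2_add blinfun.add_right)
  show "c *\<^sub>C x \<in> lag_family r Q" if mem: "x \<in> lag_family r Q" for c x
  proof -
    obtain h n where x: "x = (h, lag_second r Q h n)" "total_L2 h = n + blinfun_apply Q n"
      using mem by (auto simp: lag_family_def)
    then have "total_L2 (c *\<^sub>C h) = c *s n + blinfun_apply Q (c *s n)"
      using assms by (simp add: total_L2_scaleC unitary_op_def vector_add_ldistrib)
    then show ?thesis
      unfolding x scaleC_prod_def fst_conv snd_conv scale lag_family_def by blast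
  qed
qed

lemma cinner_lag_second_left:
  "cinner (lag_second r Q h n) x =
    \<i> * (vec_cinner ((1 - r) *\<^sub>R blinfun_apply Q n - n) (total_L2 x) + r *\<^sub>R cinner (primitive_L2 h) x)"
  by (simp only: lag_second_def cinner_scaleC_left cinner_add_left cinner_scaleR_left cinner_const_L2_left)

lemma cinner_lag_second_right:
  "cinner x (lag_second r Q h n) =
    - \<i> * (vec_cinner (total_L2 x) ((1 - r) *\<^sub>R blinfun_apply Q n - n) + r *\<^sub>R cinner x (primitive_L2 h))"
  by (simp only: lag_second_def cinner_scaleC_right cinner_add_right cinner_scaleR_right
      cinner_const_L2_right complex_cnj_i)

text \<open>For isotropy, integration by parts turns the primitives into a pairing of totals, and
  unitarity cancels this against the constant terms. For maximality, an orthogonal vector yields the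
  totals \<open>u\<close> and \<open>\<mu>\<close>, from which \<open>n\<close> is recovered by
  linear algebra; that needs division by \<open>2 - r\<close>, which is at least 1.\<close>

lemma lag_family_in_Lag:
  assumes Q: "unitary_op Q" and r: "0 \<le> r" "r \<le> 1"
  shows "lag_family r Q \<in> Lag"
proof -
  have iso: "vec_cinner (blinfun_apply Q v) (blinfun_apply Q w) = vec_cinner v w" for v w
    using Q by (simp add: unitary_op_def)
  have "Jhat p \<in> cortho (lag_family r Q)" if p: "p \<in> lag_family r Q" for p
    unfolding cortho_def
  proof (intro CollectI ballI)
    fix p' assume "p' \<in> lag_family r Q"
    with p obtain h n h' n' where
      p: "p = (h, lag_second r Q h n)" "total_L2 h = n + blinfun_apply Q n" and
      p': "p' = (h', lag_second r Q h' n')" "total_L2 h' = n' + blinfun_apply Q n'"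
      by (auto simp: lag_family_def)
    have parts: "cinner (primitive_L2 h) h' = vec_cinner (total_L2 h) (total_L2 h') - cinner h (primitive_L2 h')"
      using cinner_primitive_L2[of h h'] by (simp add: eq_diff_eq)
    show "cinner (Jhat p) p' = 0"
      by (simp add: p p' Jhat_def cinner_prod_def cinner_lag_second_left cinner_lag_second_right parts
          L2_linear_simps vec_cinner_simps iso scaleR_conv_of_real[where 'a = complex] algebra_simps)
  qed
  moreover have "p \<in> Jhat ` lag_family r Q" if p: "p \<in> cortho (lag_family r Q)" for p
  proof -
    define h where "h = - snd p"
    define k where "k = fst p"
    define u where "u = total_L2 h"
    \<comment> \<open>Integration by parts moves the primitive from \<open>h'\<close> to
      \<open>h\<close>. Once it is absorbed into \<open>k'\<close>, the pairing with
      \<open>h'\<close> depends on \<open>n\<close> alone.\<close>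
    define k' where "k' = k - \<i> *\<^sub>C (r *\<^sub>R primitive_L2 h)"
    have orth: "cinner k' h' = - \<i> * vec_cinner u (blinfun_apply Q n - (1 - r) *\<^sub>R n)"
      if h': "total_L2 h' = n + blinfun_apply Q n" for h' n
    proof -
      have "(h', lag_second r Q h' n) \<in> lag_family r Q"
        using h' by (auto simp: lag_family_def)
      with p have "cinner p (h', lag_second r Q h' n) = 0"
        by (simp add: cortho_def)
      then have "cinner k h' = cinner h (lag_second r Q h' n)"
        by (simp add: cinner_prod_def h_def k_def add_eq_0_iff2)
      moreover have "cinner h (primitive_L2 h') = vec_cinner u (total_L2 h') - cinner (primitive_L2 h) h'"
        using cinner_primitive_L2[of h h'] by (simp add: eq_diff_eq add.commute u_def)
      ultimately show ?thesis
        by (simp add: k'_def cinner_lag_second_right cinner_diff_left cinner_scaleC_left cinner_scaleR_left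
            u_def[symmetric] h' vec_cinner_simps algebra_simps)
    qed
    define m where "m = total_L2 k'"
    have "k' = const_L2 m"
    proof -
      define w where "w = k' - const_L2 m"
      have w: "total_L2 w = 0"
        by (simp add: w_def m_def L2_linear_simps)
      then have "cinner k' w = 0"
        \<comment> \<open>With \<open>n = 0\<close> the test functions are those of total 0, so
          \<open>k'\<close> is orthogonal to all of \<open>W\<close> and is constant.\<close>
        using orth[of w 0] by (simp add: blinfun.zero_right vec_cinner_simps)
      moreover have "cinner (const_L2 m) w = 0"
        by (simp add: cinner_const_L2_left w vec_cinner_simps)
      ultimately have "cinner w w = 0"
        by (simp add: cinner_diff_left w_def)
      then have "inner w w = 0"
        by (simp add: inner_eq_Re_cinner)
      then show ?thesis by (simp add: w_def)
    qed
    define \<mu> where "\<mu> = - \<i> *s m"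
    have m: "m = \<i> *s \<mu>"
      by (simp add: \<mu>_def vector_smult_assoc)
    \<comment> \<open>Eliminates \<open>Q n\<close> from the two equations wanted,
      \<open>u = n + Q n\<close> and \<open>\<mu> = (1 - r) Q n - n\<close>. The value of
      \<open>Q n\<close> that they require is then verified by testing against the vectors
      \<open>Q v\<close>.\<close>
    define n where "n = (1 / (2 - r)) *\<^sub>R ((1 - r) *\<^sub>R u - \<mu>)"
    have r2: "2 - r \<noteq> 0" using r by simp
    have n: "(2 - r) *\<^sub>R n = (1 - r) *\<^sub>R u - \<mu>"
      using r2 by (simp add: n_def)
    have "u + \<mu> = (2 - r) *\<^sub>R blinfun_apply Q n"
    proof (rule vec_cinner_eqI)
      fix w
      obtain v where v: "w = blinfun_apply Q v"
        using Q unfolding unitary_op_def by (metis surjD)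
      have "vec_cinner m (v + blinfun_apply Q v) = - \<i> * vec_cinner u (blinfun_apply Q v - (1 - r) *\<^sub>R v)"
        using orth[of "const_L2 (v + blinfun_apply Q v)" v]
        by (simp add: \<open>k' = const_L2 m\<close> cinner_const_L2_left)
      then have "\<i> * vec_cinner \<mu> (v + blinfun_apply Q v) = \<i> * (- vec_cinner u (blinfun_apply Q v - (1 - r) *\<^sub>R v))"
        by (simp add: m vec_cinner_scaleC_left)
      then have "vec_cinner \<mu> (v + blinfun_apply Q v) = - vec_cinner u (blinfun_apply Q v - (1 - r) *\<^sub>R v)"
        by (simp only: mult_cancel_left) simp
      then have "vec_cinner (u + \<mu>) w = vec_cinner ((1 - r) *\<^sub>R u - \<mu>) v"
        by (simp add: v vec_cinner_simps algebra_simps)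
      also have "\<dots> = vec_cinner ((2 - r) *\<^sub>R n) v"
        by (simp only: n)
      also have "\<dots> = vec_cinner ((2 - r) *\<^sub>R blinfun_apply Q n) w"
        by (simp add: v vec_cinner_simps iso)
      finally show "vec_cinner (u + \<mu>) w = vec_cinner ((2 - r) *\<^sub>R blinfun_apply Q n) w" .
    qed
    then have Qn: "(2 - r) *\<^sub>R blinfun_apply Q n = u + \<mu>" by simp
    have "(2 - r) *\<^sub>R (n + blinfun_apply Q n) = (2 - r) *\<^sub>R u"
      unfolding scaleR_add_right n Qn by (simp add: algebra_simps scaleR_2)
    then have u: "total_L2 h = n + blinfun_apply Q n"
      using r2 by (simp add: u_def)
    have "(2 - r) *\<^sub>R ((1 - r) *\<^sub>R blinfun_apply Q n - n)
        = (1 - r) *\<^sub>R ((2 - r) *\<^sub>R blinfun_apply Q n) - (2 - r) *\<^sub>R n"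
      by (simp add: scaleR_diff_right mult.commute)
    also have "\<dots> = (2 - r) *\<^sub>R \<mu>"
      unfolding n Qn by (simp add: algebra_simps scaleR_2)
    finally have \<mu>: "(1 - r) *\<^sub>R blinfun_apply Q n - n = \<mu>"
      using r2 by simp
    have "k = const_L2 m + \<i> *\<^sub>C (r *\<^sub>R primitive_L2 h)"
      using \<open>k' = const_L2 m\<close> by (simp add: k'_def algebra_simps)
    then have "k = lag_second r Q h n"
      unfolding lag_second_def \<mu> by (simp add: m const_L2_scaleC scaleC_add_right)
    with u have "(h, k) \<in> lag_family r Q"
      by (auto simp: lag_family_def)
    moreover have "p = Jhat (h, k)"
      by (simp add: Jhat_def h_def k_def)
    ultimately show ?thesis by blast
  qed
  ultimately show ?thesis
    using csubspace_lag_family[OF Q] by (auto simp: Lag_def)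
qed

section \<open>The Fredholm conditions defining \<open>Lag_minus\<close>\<close>

lemma cfinite_dim_subspace:
  assumes "csubspace V" "finite T" "V \<subseteq> cspan T"
  shows "cfinite_dim V"
proof -
  obtain B where B: "B \<subseteq> V" "\<not> complex_vector.dependent B" "V \<subseteq> cspan B"
    using complex_vector.maximal_independent_subset by blast
  have "finite B"
    using complex_vector.independent_span_bound[OF assms(2) B(2)] B(1) assms(3) by blast
  moreover have "cspan B = V"
    using complex_vector.span_minimal[OF B(1) assms(1)] B(3) by blast
  ultimately show ?thesis
    by (auto simp: cfinite_dim_def)
qed

text \<open>On the intersection with \<open>Hminus\<close> one has \<open>h = 0\<close>, so the
  primitive drops out and only constants remain. The sum with \<open>Hminus\<close> constrains just
  the total of the first component, to the range of \<open>1 + Q\<close>; it is the preimage of a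
  finite-dimensional subspace under a continuous map.\<close>

lemma lag_family_in_Lag_minus:
  assumes Q: "unitary_op Q" and r: "0 \<le> r" "r \<le> 1"
  shows "lag_family r Q \<in> Lag_minus"
proof -
  have "cfinite_dim (lag_family r Q \<inter> Hminus)"
  proof (rule cfinite_dim_subspace)
    have "csubspace Hminus"
      by (rule complex_vector.subspaceI) (auto simp: Hminus_def scaleC_prod_def zero_prod_def)
    then show "csubspace (lag_family r Q \<inter> Hminus)"
      by (intro complex_vector.subspace_inter csubspace_lag_family Q)
    define e where "e i = (0 :: 'a L2, const_L2 (axis i 1 :: complex^'a))" for i
    show "finite (range e)" by simp
    have span: "(0, const_L2 v) \<in> cspan (range e)" for v
    proof -
      have "(0, const_L2 v) = (\<Sum>i\<in>UNIV. (v $ i) *\<^sub>C e i)"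
        by (simp add: e_def scaleC_prod_def sum_prod const_L2_scaleC[symmetric]
            linear_sum[OF const_L2_linear, symmetric] basis_expansion)
      then show ?thesis
        by (simp add: complex_vector.span_sum complex_vector.span_scale complex_vector.span_base)
    qed
    show "lag_family r Q \<inter> Hminus \<subseteq> cspan (range e)"
      by (auto simp: lag_family_def Hminus_def lag_second_def linear_0[OF primitive_L2_linear]
          const_L2_scaleC[symmetric] intro: span)
  qed
  moreover have "closed {x + y | x y. x \<in> lag_family r Q \<and> y \<in> Hminus}"
  proof -
    define R where "R = range (\<lambda>n. n + blinfun_apply Q n)"
    have "linear (\<lambda>n. n + blinfun_apply Q n)"
      by (intro linear_compose_add linear_ident bounded_linear.linear blinfun.bounded_linear_right)
    then have "closed R"
      unfolding R_def by (intro closed_subspace linear_subspace_image) auto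
    moreover have "continuous_on UNIV (\<lambda>p :: 'a Hhat. total_L2 (fst p))"
      by (intro linear_continuous_on bounded_linear_compose[OF bounded_linear_total_L2] bounded_linear_fst)
    moreover have "{x + y | x y. x \<in> lag_family r Q \<and> y \<in> Hminus} = (\<lambda>p. total_L2 (fst p)) -` R"
    proof (intro set_eqI iffI)
      fix p :: "'a Hhat"
      assume "p \<in> (\<lambda>p. total_L2 (fst p)) -` R"
      then obtain n where "total_L2 (fst p) = n + blinfun_apply Q n" by (auto simp: R_def)
      then have "(fst p, lag_second r Q (fst p) n) \<in> lag_family r Q"
        by (auto simp: lag_family_def)
      moreover have "(0, snd p - lag_second r Q (fst p) n) \<in> Hminus"
        by (simp add: Hminus_def)
      moreover have "p = (fst p, lag_second r Q (fst p) n) + (0, snd p - lag_second r Q (fst p) n)"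
        by (simp add: prod_eq_iff)
      ultimately show "p \<in> {x + y | x y. x \<in> lag_family r Q \<and> y \<in> Hminus}" by blast
    qed (auto simp: lag_family_def Hminus_def R_def)
    ultimately show ?thesis
      by (simp add: continuous_on_closed_vimage)
  qed
  ultimately show ?thesis
    using lag_family_in_Lag[OF assms] by (simp add: Lag_minus_def)
qed

text \<open>By injectivity of \<open>Jhat\<close>, a lagrangian is the preimage under this
  continuous map of an orthogonal complement.\<close>

lemma Lag_closed:
  assumes "L \<in> Lag"
  shows "closed L"
proof -
  have "L = Jhat -` cortho L"
  proof -
    have "inj (Jhat :: 'a Hhat \<Rightarrow> _)"
      by (auto simp: inj_def Jhat_def prod_eq_iff)
    then show ?thesis
      using assms inj_vimage_image_eq[of Jhat L] by (simp add: Lag_def)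
  qed
  moreover have "continuous_on UNIV (Jhat :: 'a Hhat \<Rightarrow> _)"
    unfolding Jhat_def[abs_def] by (intro continuous_intros)
  ultimately show ?thesis
    using closed_cortho[of L] by (metis continuous_on_closed_vimage closed_UNIV inf_top.right_neutral)
qed

text \<open>The pairs \<open>(h, n)\<close> with \<open>total_L2 h = n + Q n\<close> form a space
  that varies with \<open>Q\<close>. The substitution \<open>n = total_L2 z\<close>,
  \<open>h = z + const_L2 (Q n)\<close> parametrizes them by one fixed space. Writing everything as
  compositions of bounded operators makes norm continuity in \<open>r\<close> and \<open>Q\<close>
  automatic.\<close>

definition lag_param ::
  "real \<Rightarrow> ((complex^'n) \<Rightarrow>\<^sub>L (complex^'n)) \<Rightarrow> 'n::finite L2 \<Rightarrow>\<^sub>L 'n Hhat" where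
  "lag_param r Q =
    (let T = Blinfun total_L2; C = Blinfun const_L2;
       A = id_blinfun + (C o\<^sub>L Q o\<^sub>L T);
       B = Blinfun (\<lambda>x. \<i> *\<^sub>C x) o\<^sub>L
         ((1 - r) *\<^sub>R (C o\<^sub>L Q o\<^sub>L T) - (C o\<^sub>L T) + r *\<^sub>R (Blinfun primitive_L2 o\<^sub>L A))
     in (Blinfun (\<lambda>x. (x, 0)) o\<^sub>L A) + (Blinfun (\<lambda>x. (0, x)) o\<^sub>L B))"

lemma bounded_linear_Pair_zero: "bounded_linear (\<lambda>x. (x, 0))" "bounded_linear (\<lambda>x. (0, x))"
  by (intro bounded_linear_Pair bounded_linear_ident bounded_linear_zero)+

lemma lag_param_apply:
  "blinfun_apply (lag_param r Q) z =
    (z + const_L2 (blinfun_apply Q (total_L2 z)),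
     lag_second r Q (z + const_L2 (blinfun_apply Q (total_L2 z))) (total_L2 z))"
  by (simp add: lag_param_def Let_def blinfun.add_left blinfun.diff_left blinfun.scaleR_left lag_second_def
      bounded_linear_Blinfun_apply bounded_linear_total_L2 bounded_linear_const_L2
      bounded_linear_primitive_L2 bounded_linear_scaleC bounded_linear_Pair_zero L2_linear_simps)

lemma range_lag_param: "range (blinfun_apply (lag_param r Q)) = lag_family r Q"
proof (intro set_eqI iffI)
  fix p assume "p \<in> lag_family r Q"
  then obtain h n where p: "p = (h, lag_second r Q h n)" "total_L2 h = n + blinfun_apply Q n"
    by (auto simp: lag_family_def)
  have "total_L2 (h - const_L2 (blinfun_apply Q n)) = n"
    by (simp add: L2_linear_simps p)
  then have "blinfun_apply (lag_param r Q) (h - const_L2 (blinfun_apply Q n)) = p"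
    by (simp add: lag_param_apply p)
  then show "p \<in> range (blinfun_apply (lag_param r Q))" by blast
qed (auto simp: lag_param_apply lag_family_def L2_linear_simps)

text \<open>The constant part \<open>m\<close> is controlled by \<open>y\<close> and
  \<open>h\<close>, because \<open>total_L2\<close> is a left inverse of \<open>const_L2\<close> of
  norm at most 1. The elimination behind maximality,
  \<open>(2 - r) n = (1 - r) total_L2 h - m\<close>, then gives |n| \<le> |h| + |y|. Hence |z| \<le>
  |h| + |n| \<le> 2 |h| + |y|, which explains the 3.\<close>

lemma lag_param_bounded_below:
  assumes Q: "unitary_op Q" and r: "0 \<le> r" "r \<le> 1"
  shows "norm z \<le> 3 * norm (blinfun_apply (lag_param r Q) z)"
proof -
  define n where "n = total_L2 z"
  define h where "h = z + const_L2 (blinfun_apply Q n)"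
  define y where "y = lag_second r Q h n"
  define m where "m = (1 - r) *\<^sub>R blinfun_apply Q n - n"
  have p: "blinfun_apply (lag_param r Q) z = (h, y)"
    by (simp add: lag_param_apply n_def h_def y_def)
  have le: "norm h \<le> norm (h, y)" "norm y \<le> norm (h, y)"
    by (simp_all add: norm_Pair)
  have u: "total_L2 h = n + blinfun_apply Q n"
    by (simp add: h_def n_def L2_linear_simps)
  have "m = total_L2 (const_L2 m)" by simp
  also have "const_L2 m = - \<i> *\<^sub>C y - r *\<^sub>R primitive_L2 h"
    by (simp add: y_def lag_second_def m_def[symmetric] scaleC_scaleC scaleC_minus_left)
  finally have "norm m \<le> norm (- \<i> *\<^sub>C y - r *\<^sub>R primitive_L2 h)"
    by (metis norm_total_L2_le)
  also have "\<dots> \<le> norm y + r * norm h"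
    using norm_triangle_ineq4[of "- \<i> *\<^sub>C y" "r *\<^sub>R primitive_L2 h"]
      mult_left_mono[OF norm_primitive_L2_le[of h] r(1)] r(1) by (simp add: norm_scaleC)
  finally have m: "norm m \<le> norm y + r * norm h" .
  have "(2 - r) *\<^sub>R n = (1 - r) *\<^sub>R total_L2 h - m"
    by (simp add: u m_def algebra_simps scaleR_2)
  then have "norm ((2 - r) *\<^sub>R n) \<le> norm ((1 - r) *\<^sub>R total_L2 h) + norm m"
    by (metis norm_triangle_ineq4)
  also have "\<dots> \<le> (1 - r) * norm h + (norm y + r * norm h)"
    using m mult_left_mono[OF norm_total_L2_le[of h], of "1 - r"] r(2) by simp
  also have "norm ((2 - r) *\<^sub>R n) = (2 - r) * norm n"
    using r(2) by simp
  finally have "(2 - r) * norm n \<le> norm h + norm y"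
    by (simp add: algebra_simps)
  moreover have "1 * norm n \<le> (2 - r) * norm n"
    using r(2) by (intro mult_right_mono) auto
  ultimately have n: "norm n \<le> norm h + norm y" by linarith
  have "norm z \<le> norm h + norm (const_L2 (blinfun_apply Q n))"
    using norm_triangle_ineq4[of h "const_L2 (blinfun_apply Q n)"] by (simp add: h_def)
  also have "\<dots> \<le> norm h + norm n"
    using norm_const_L2_le[of "blinfun_apply Q n"] unitary_op_norm[OF Q] by simp
  finally show ?thesis
    using n le unfolding p by linarith
qed

lemma continuous_on_lag_param:
  fixes r :: "'p::topological_space \<Rightarrow> real" and Q :: "'p \<Rightarrow> (complex^'n) \<Rightarrow>\<^sub>L (complex^'n)"
  assumes "continuous_on S r" "continuous_on S Q"
  shows "continuous_on S (\<lambda>p. lag_param (r p) (Q p))"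
  unfolding lag_param_def Let_def
  by (intro continuous_intros assms bounded_bilinear.continuous_on[OF bounded_bilinear_blinfun_compose])

section \<open>Rotated unitaries and the two ends of the homotopy\<close>

definition rotated_op :: "real \<Rightarrow> complex^'n^'n \<Rightarrow> (complex^'n) \<Rightarrow>\<^sub>L (complex^'n)" where
  "rotated_op s U = Blinfun (\<lambda>v. cis (pi * (1 - s)) *s (U *v v))"

lemma rotated_op_apply [simp]: "blinfun_apply (rotated_op s U) v = cis (pi * (1 - s)) *s (U *v v)"
  unfolding rotated_op_def
  by (simp add: bounded_linear_Blinfun_apply bounded_linear_compose[OF bounded_linear_vec_scaleC bounded_linear_matrix_vector])

text \<open>On a finite-dimensional domain, continuity of the values at each vector already gives
  continuity in the operator norm.\<close>

lemma continuous_on_rotated_op: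
  "continuous_on S (\<lambda>p :: real \<times> (complex^'n^'n). rotated_op (fst p) (snd p))"
proof (rule continuous_on_blinfun_componentwise)
  fix b :: "complex^'n"
  show "continuous_on S (\<lambda>p. blinfun_apply (rotated_op (fst p) (snd p)) b)"
    unfolding rotated_op_apply vector_scalar_mult_def matrix_vector_mult_def
    by (intro continuous_intros)
qed

lemma vec_cinner_adjoint: "vec_cinner (A *v v) w = vec_cinner v (adjoint_matrix A *v w)"
proof -
  have "vec_cinner (A *v v) w = (\<Sum>i\<in>UNIV. \<Sum>j\<in>UNIV. A $ i $ j * v $ j * cnj (w $ i))"
    by (simp add: vec_cinner_def matrix_vector_mult_def sum_distrib_right)
  also have "\<dots> = (\<Sum>j\<in>UNIV. \<Sum>i\<in>UNIV. A $ i $ j * v $ j * cnj (w $ i))"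
    by (rule sum.swap)
  also have "\<dots> = vec_cinner v (adjoint_matrix A *v w)"
    by (simp add: vec_cinner_def matrix_vector_mult_def adjoint_matrix_def map_matrix_def transpose_def
        sum_distrib_left mult_ac)
  finally show ?thesis .
qed

lemma unitary_op_rotated_op:
  assumes "U \<in> unitary_group"
  shows "unitary_op (rotated_op s U)"
  unfolding unitary_op_def
proof (intro conjI allI)
  have U: "adjoint_matrix U ** U = mat 1" "U ** adjoint_matrix U = mat 1"
    using assms by (auto simp: unitary_group_def)
  show "blinfun_apply (rotated_op s U) (c *s v) = c *s blinfun_apply (rotated_op s U) v" for c v
    by (simp add: vector_scalar_commute vector_smult_assoc mult.commute)
  show "vec_cinner (blinfun_apply (rotated_op s U) v) (blinfun_apply (rotated_op s U) w) = vec_cinner v w" for v w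
    by (simp add: vec_cinner_scaleC_left vec_cinner_scaleC_right vec_cinner_adjoint matrix_vector_mul_assoc U
        mult.assoc[symmetric] cis_cnj cis_mult)
  have "blinfun_apply (rotated_op s U) (cis (- (pi * (1 - s))) *s (adjoint_matrix U *v w)) = w" for w
    by (simp add: vector_scalar_commute vector_smult_assoc cis_mult matrix_vector_mul_assoc U)
  then show "surj (blinfun_apply (rotated_op s U))"
    by (rule surjI)
qed

text \<open>The dictionary is h = -i f' and n = i f(0). Since \<open>rotated_op 0 U\<close> acts as
  \<open>-U\<close>, the condition on the total of \<open>h\<close> becomes f(1) - f(0) = U f(0) -
  f(0).\<close>

lemma lag_family_one: "lag_family 1 (rotated_op 0 U) = universal_family U"
  unfolding universal_family_eq
proof (intro set_eqI iffI)
  fix p assume "p \<in> lag_family 1 (rotated_op 0 U)"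
  then obtain h n where p: "p = (h, \<i> *\<^sub>C (const_L2 (- n) + primitive_L2 h))" "total_L2 h = n - U *v n"
    by (auto simp: lag_family_def lag_second_def)
  have "p = (- \<i> *\<^sub>C (\<i> *\<^sub>C h), const_L2 (- \<i> *s n) + primitive_L2 (\<i> *\<^sub>C h))"
    by (simp add: p scaleC_scaleC const_L2_scaleC primitive_L2_scaleC L2_linear_simps scaleC_add_right
        scaleC_diff_right scaleC_minus_left scaleC_minus_right)
  moreover have "total_L2 (\<i> *\<^sub>C h) = U *v (- \<i> *s n) - (- \<i> *s n)"
    by (simp add: total_L2_scaleC p vector_scalar_commute[symmetric] vector_ssub_ldistrib vec_eq_iff
        linear_neg[OF bounded_linear.linear[OF bounded_linear_matrix_vector]])
  ultimately show "p \<in> {(- \<i> *\<^sub>C h, const_L2 v + primitive_L2 h) | h v. total_L2 h = U *v v - v}"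
    by blast
next
  fix p assume "p \<in> {(- \<i> *\<^sub>C h, const_L2 v + primitive_L2 h) | h v. total_L2 h = U *v v - v}"
  then obtain h v where p: "p = (- \<i> *\<^sub>C h, const_L2 v + primitive_L2 h)" "total_L2 h = U *v v - v"
    by blast
  have "p = (- \<i> *\<^sub>C h, lag_second 1 (rotated_op 0 U) (- \<i> *\<^sub>C h) (\<i> *s v))"
    by (simp add: p lag_second_def const_L2_scaleC primitive_L2_scaleC L2_linear_simps scaleC_add_right
        scaleC_diff_right scaleC_scaleC scaleC_minus_left scaleC_minus_right)
  moreover have "total_L2 (- \<i> *\<^sub>C h) = \<i> *s v + blinfun_apply (rotated_op 0 U) (\<i> *s v)"
    unfolding total_L2_scaleC p
    by (simp add: vector_scalar_commute vector_ssub_ldistrib vec_eq_iff)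
  ultimately show "p \<in> lag_family 1 (rotated_op 0 U)"
    by (auto simp: lag_family_def)
qed

lemma in_Wspace_iff: "w \<in> Wspace \<longleftrightarrow> total_L2 w = 0"
  by (auto simp: Wspace_def cortho_def cinner_const_L2_right vec_cinner_simps intro: vec_cinner_eqI)

text \<open>At \<open>r = 0\<close> the primitive has disappeared and \<open>h\<close> is restricted
  through its mean only. Splitting off the mean leaves an arbitrary element of
  \<open>Wspace\<close>.\<close>

lemma lag_family_zero: "lag_family 0 (rotated_op 1 U) = arnold_inclusion U"
proof (intro set_eqI iffI)
  fix p assume "p \<in> lag_family 0 (rotated_op 1 U)"
  then obtain h n where p: "p = (h, \<i> *\<^sub>C const_L2 (U *v n - n))" "total_L2 h = n + U *v n"
    by (auto simp: lag_family_def lag_second_def)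
  have "p = (const_L2 (n + U *v n) + (h - const_L2 (n + U *v n)), const_L2 (- \<i> *s (n - U *v n)))"
    by (simp add: p const_L2_scaleC L2_linear_simps scaleC_diff_right scaleC_minus_left)
  moreover have "(n + U *v n, - \<i> *s (n - U *v n)) \<in> arnold U"
    by (auto simp: arnold_def matrix_vector_mult_add_rdistrib matrix_vector_mult_diff_rdistrib)
  moreover have "h - const_L2 (n + U *v n) \<in> Wspace"
    unfolding in_Wspace_iff by (simp add: L2_linear_simps p)
  ultimately show "p \<in> arnold_inclusion U"
    unfolding arnold_inclusion_def by blast
next
  fix p assume "p \<in> arnold_inclusion U"
  then obtain n w where p: "p = (const_L2 (n + U *v n) + w, const_L2 (- \<i> *s (n - U *v n)))" "total_L2 w = 0"
    by (auto simp: arnold_inclusion_def arnold_def in_Wspace_iff matrix_vector_mult_add_rdistrib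
        matrix_vector_mult_diff_rdistrib)
  have "p = (const_L2 (n + U *v n) + w, lag_second 0 (rotated_op 1 U) (const_L2 (n + U *v n) + w) n)"
    by (simp add: p lag_second_def const_L2_scaleC L2_linear_simps scaleC_diff_right scaleC_minus_left)
  moreover have "total_L2 (const_L2 (n + U *v n) + w) = n + blinfun_apply (rotated_op 1 U) n"
    by (simp add: L2_linear_simps p)
  ultimately show "p \<in> lag_family 0 (rotated_op 1 U)"
    unfolding lag_family_def by blast
qed

theorem proposition2p59:
  shows "homotopic_with (\<lambda>_. True) (top_of_set (unitary_group :: (complex^'n^'n) set))
           Lag_minus_topology universal_family arnold_inclusion"
proof -
  define H where "H p = lag_family (1 - fst p) (rotated_op (fst p) (snd p))" for p :: "real \<times> (complex^'n^'n)"
  define S where "S = {0..1 :: real} \<times> (unitary_group :: (complex^'n^'n) set)"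
  have unitary: "unitary_op (rotated_op (fst p) (snd p))" "0 \<le> 1 - fst p" "1 - fst p \<le> 1" if "p \<in> S" for p
    using that by (auto simp: S_def unitary_op_rotated_op)
  have Lag_minus: "H p \<in> Lag_minus" if "p \<in> S" for p
    unfolding H_def using unitary[OF that] by (rule lag_family_in_Lag_minus)
  have "continuous_on S (\<lambda>p. ortho_proj (H p))"
    unfolding H_def range_lag_param[symmetric]
  proof (rule continuous_on_ortho_proj_range)
    show "continuous_on S (\<lambda>p. lag_param (1 - fst p) (rotated_op (fst p) (snd p)))"
      by (intro continuous_on_lag_param continuous_intros continuous_on_rotated_op)
    fix p assume p: "p \<in> S"
    show "csubspace (range (blinfun_apply (lag_param (1 - fst p) (rotated_op (fst p) (snd p)))))"
      unfolding range_lag_param using unitary[OF p] by (intro csubspace_lag_family)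
    show "closed (range (blinfun_apply (lag_param (1 - fst p) (rotated_op (fst p) (snd p)))))"
      unfolding range_lag_param using unitary[OF p] by (intro Lag_closed lag_family_in_Lag)
    show "\<exists>K. \<forall>z. norm z \<le> K * norm (blinfun_apply (lag_param (1 - fst p) (rotated_op (fst p) (snd p))) z)"
      using lag_param_bounded_below[OF unitary[OF p]] by blast
  qed
  \<comment> \<open>The topology on lagrangians is pulled back along \<open>ortho_proj\<close>, so
    continuity of the projections and membership in \<open>Lag_minus\<close> are all that is
    required.\<close>
  then have "continuous_map (top_of_set S) Lag_minus_topology H"
    unfolding Lag_minus_topology_def Lag_topology_def continuous_map_in_subtopology
    using Lag_minus
    by (auto simp: o_def Lag_minus_def intro!: continuous_map_pullback')
  moreover have "prod_topology (top_of_set {0..1 :: real}) (top_of_set (unitary_group :: (complex^'n^'n) set)) = top_of_set S"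
    by (simp add: S_def subtopology_Times[symmetric])
  moreover have "H (0, U) = universal_family U" "H (1, U) = arnold_inclusion U" for U
    by (simp_all add: H_def lag_family_one lag_family_zero)
  ultimately show ?thesis
    unfolding homotopic_with_def by (intro exI[of _ H]) simp
qed

end
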